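(* Let $r$ be a fixed positive integer. For each $p$, let $y_t(\cdot)=Q(\cdot)\gamma_t+\varepsilon_t(\cdot)$, where $Q(\cdot)$ is a $p\times r$ matrix of functions in $L_2(\mathcal U)$, $\gamma_t$ is an $r$-dimensional random vector with covariance matrix $\Sigma_\gamma$, and $\varepsilon_t(\cdot)$ is a $p$-vector of random functions uncorrelated with $\gamma_t$, with covariance matrix function $\Sigma_\varepsilon$; thus $\Sigma_y(u,v)=Q(u)\Sigma_\gamma Q(v)^{T}+\Sigma_\varepsilon(u,v)$. Let $\tau_1\ge\tau_2\ge\dots\ge0$ be the eigenvalues of $\Sigma_y$ (as an integral operator) with orthonormal eigenfunctions $\varphi_1(\cdot),\varphi_2(\cdot),\dots$. Suppose that $\Sigma_\gamma=I_r$; that $p^{-1}\int Q(u)^{T}Q(u)\,du=\mathrm{diag}(\vartheta_1,\dots,\vartheta_r)$, where there exist constants $\overline\vartheta>\underline\vartheta>0$ such that $\overline\vartheta>\vartheta_1>\vartheta_2>\dots>\vartheta_r>\underline\vartheta$; and that $\|\Sigma_\varepsilon\|_{\mathcal L}=o(p)$. Let $\widetilde q_1(\cdot),\dots,\widetilde q_r(\cdot)$ be the columns of $Q(\cdot)$ normalized so that $\|\widetilde q_j\|=1$ for $j\in[r]$. Then: (i) $|\tau_j-p\vartheta_j|\le\|\Sigma_\varepsilon\|_{\mathcal L}$ for $j\in[r]$, and $|\tau_j|\le\|\Sigma_\varepsilon\|_{\mathcal L}$ for $j\in[p]\setminus[r]$; (ii) $\|\varphi_j-\widetilde q_j\|=O(p^{-1}\|\Sigma_\varepsilon\|_{\mathcal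 L})$ for $j\in[r]$.
   Context: $\mathcal U$ is a compact interval, $\mathbb H=L_2(\mathcal U)$, $[m]=\{1,\dots,m\}$. For $f,g\in\mathbb H^p$, $\langle f,g\rangle=\int_{\mathcal U}f(u)^{T}g(u)\,du$ and $\|f\|=\langle f,f\rangle^{1/2}$. The covariance matrix function of $z_t(\cdot)$ is $\Sigma_z(u,v)=\mathrm{Cov}\{z_t(u),z_t(v)\}$; it is identified with the integral operator $\Sigma_z(f)(\cdot)=\int_{\mathcal U}\Sigma_z(\cdot,v)f(v)\,dv$ on $\mathbb H^p$. $\|K\|_{\mathcal L}=\sup_{\|x\|\le1}\|K(x)\|$ is the operator norm. By the multivariate Mercer theorem, $\Sigma_y(u,v)=\sum_{i\ge1}\tau_i\varphi_i(u)\varphi_i(v)^{T}$. Asymptotics are as $p\to\infty$.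
   Formalization: In (ii) the bound is proved for φ_j up to sign, since eigenfunctions are determined only up to sign; if the ϑ_j vary with p, (ii) also assumes that the gaps ϑ_j − ϑ_{j+1} are bounded below uniformly in p (automatic for fixed ϑ_j). *)

theory Defs
  imports "HOL-Probability.Probability" "HOL-Library.Landau_Symbols"
begin

text \<open>
  An element \<open>f\<close> of \<open>L\<^sub>2[a,b]\<^sup>p\<close> is represented by its components
  \<open>f i u\<close> with \<open>i \<in> {1..p}\<close> and \<open>u \<in> [a,b]\<close>; components with an index outside
  \<open>{1..p}\<close> are ignored everywhere, and elements of \<open>L\<^sub>2\<close> are only determined
  almost everywhere. The dimension \<open>p\<close> is an explicit argument because it tends to infinity.
\<close>

abbreviation leb_Icc :: "real \<Rightarrow> real \<Rightarrow> real measure" where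
  "leb_Icc a b \<equiv> restrict_space lborel {a..b}"

definition L2_vec :: "real \<Rightarrow> real \<Rightarrow> nat \<Rightarrow> (nat \<Rightarrow> real \<Rightarrow> real) set" where
  "L2_vec a b p = {f. \<forall>i\<in>{1..p}. f i \<in> borel_measurable (leb_Icc a b) \<and>
      integrable (leb_Icc a b) (\<lambda>u. (f i u)\<^sup>2)}"

definition L2_inner :: "real \<Rightarrow> real \<Rightarrow> nat \<Rightarrow> (nat \<Rightarrow> real \<Rightarrow> real) \<Rightarrow> (nat \<Rightarrow> real \<Rightarrow> real) \<Rightarrow> real" where
  "L2_inner a b p f g = (LINT u|leb_Icc a b. (\<Sum>i\<in>{1..p}. f i u * g i u))"

definition L2_norm :: "real \<Rightarrow> real \<Rightarrow> nat \<Rightarrow> (nat \<Rightarrow> real \<Rightarrow> real) \<Rightarrow> real" where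
  "L2_norm a b p f = sqrt (L2_inner a b p f f)"

text \<open>A \<open>p \<times> p\<close> matrix-valued kernel \<open>K\<close> has the entries \<open>K i j u v\<close>.\<close>

definition kernel_op ::
  "real \<Rightarrow> real \<Rightarrow> nat \<Rightarrow> (nat \<Rightarrow> nat \<Rightarrow> real \<Rightarrow> real \<Rightarrow> real) \<Rightarrow>
    (nat \<Rightarrow> real \<Rightarrow> real) \<Rightarrow> nat \<Rightarrow> real \<Rightarrow> real" where
  "kernel_op a b p K f = (\<lambda>i u. LINT v|leb_Icc a b. (\<Sum>j\<in>{1..p}. K i j u v * f j v))"

definition kernel_opnorm ::
  "real \<Rightarrow> real \<Rightarrow> nat \<Rightarrow> (nat \<Rightarrow> nat \<Rightarrow> real \<Rightarrow> real \<Rightarrow> real) \<Rightarrow> real" where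
  "kernel_opnorm a b p K =
    (SUP f \<in> {f \<in> L2_vec a b p. L2_norm a b p f \<le> 1}. L2_norm a b p (kernel_op a b p K f))"

text \<open>
  Ordered eigenvalues \<open>\<tau> 1 \<ge> \<tau> 2 \<ge> \<dots> \<ge> 0\<close> (with multiplicity) and
  orthonormal eigenfunctions \<open>\<phi> 1, \<phi> 2, \<dots>\<close> of the integral operator of \<open>K\<close>. That
  no nonzero eigenvalue is left out is expressed by the Mercer expansion
  \<open>K(u,v) = (\<Sum>k. \<tau> k \<phi> k (u) \<phi> k (v)\<^sup>T)\<close>, the series converging in
  \<open>L\<^sub>2([a,b] \<times> [a,b])\<close> because kernels need not be continuous. If only finitely many
  eigenvalues are nonzero, the sequence continues with elements of the null space.
\<close>

definition mercer_system ::
  "real \<Rightarrow> real \<Rightarrow> nat \<Rightarrow> (nat \<Rightarrow> nat \<Rightarrow> real \<Rightarrow> real \<Rightarrow> real) \<Rightarrow>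
    (nat \<Rightarrow> real) \<Rightarrow> (nat \<Rightarrow> nat \<Rightarrow> real \<Rightarrow> real) \<Rightarrow> bool" where
  "mercer_system a b p K \<tau> \<phi> \<longleftrightarrow>
    (\<forall>k\<ge>1. 0 \<le> \<tau> (Suc k) \<and> \<tau> (Suc k) \<le> \<tau> k) \<and>
    (\<forall>k\<ge>1. \<phi> k \<in> L2_vec a b p) \<and>
    (\<forall>k\<ge>1. \<forall>l\<ge>1. L2_inner a b p (\<phi> k) (\<phi> l) = (if k = l then 1 else 0)) \<and>
    (\<forall>k\<ge>1. \<forall>i\<in>{1..p}. AE u in leb_Icc a b. kernel_op a b p K (\<phi> k) i u = \<tau> k * \<phi> k i u) \<and>
    (\<forall>i\<in>{1..p}. \<forall>j\<in>{1..p}.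
      (\<lambda>n. LINT (u, v)|(leb_Icc a b \<Otimes>\<^sub>M leb_Icc a b).
         (K i j u v - (\<Sum>k=1..n. \<tau> k * \<phi> k i u * \<phi> k j v))\<^sup>2) \<longlonglongrightarrow> 0)"

definition covariance :: "'w measure \<Rightarrow> ('w \<Rightarrow> real) \<Rightarrow> ('w \<Rightarrow> real) \<Rightarrow> real" where
  "covariance M X Y =
    (LINT w|M. (X w - (LINT w'|M. X w')) * (Y w - (LINT w'|M. Y w')))"

text \<open>
  A \<open>p\<close>-vector \<open>z\<close> of random functions on \<open>[a,b]\<close> with second moments, \<open>z i u\<close> being the
  random variable at the point \<open>u\<close> of the \<open>i\<close>-th component: pointwise second moments make the
  covariance matrix function well defined, and \<open>E \<parallel>z\<parallel>\<^sup>2 < \<infinity>\<close> makes it the kernel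
  of a bounded operator on \<open>L\<^sub>2[a,b]\<^sup>p\<close>.
\<close>

definition random_functions ::
  "'w measure \<Rightarrow> real \<Rightarrow> real \<Rightarrow> nat \<Rightarrow> (nat \<Rightarrow> real \<Rightarrow> 'w \<Rightarrow> real) \<Rightarrow> bool" where
  "random_functions M a b p z \<longleftrightarrow>
    (\<forall>i\<in>{1..p}.
      (\<lambda>(w, u). z i u w) \<in> borel_measurable (M \<Otimes>\<^sub>M leb_Icc a b) \<and>
      integrable (M \<Otimes>\<^sub>M leb_Icc a b) (\<lambda>(w, u). (z i u w)\<^sup>2) \<and>
      (\<forall>u\<in>{a..b}. integrable M (\<lambda>w. (z i u w)\<^sup>2)))"

definition is_cov_function ::
  "'w measure \<Rightarrow> real \<Rightarrow> real \<Rightarrow> nat \<Rightarrow> (nat \<Rightarrow> real \<Rightarrow> 'w \<Rightarrow> real) \<Rightarrow>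
    (nat \<Rightarrow> nat \<Rightarrow> real \<Rightarrow> real \<Rightarrow> real) \<Rightarrow> bool" where
  "is_cov_function M a b p z K \<longleftrightarrow>
    (\<forall>i\<in>{1..p}. \<forall>j\<in>{1..p}. \<forall>u\<in>{a..b}. \<forall>v\<in>{a..b}.
      K i j u v = covariance M (z i u) (z j v))"

text \<open>The \<open>j\<close>-th column of a matrix of functions with entries \<open>Q i j u\<close>.\<close>

definition mat_col :: "(nat \<Rightarrow> nat \<Rightarrow> real \<Rightarrow> real) \<Rightarrow> nat \<Rightarrow> nat \<Rightarrow> real \<Rightarrow> real" where
  "mat_col Q j = (\<lambda>i u. Q i j u)"

definition normalized_col ::
  "real \<Rightarrow> real \<Rightarrow> nat \<Rightarrow> (nat \<Rightarrow> nat \<Rightarrow> real \<Rightarrow> real) \<Rightarrow> nat \<Rightarrow> nat \<Rightarrow> real \<Rightarrow> real" where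
  "normalized_col a b p Q j = (\<lambda>i u. Q i j u / L2_norm a b p (mat_col Q j))"

end

theory Submission
  imports Defs
begin

text \<open>
  Since the factors are uncorrelated with each other and with the noise,
  \<open>\<Sigma>\<^sub>y = \<Sum>\<^sub>k q\<^sub>k q\<^sub>k\<^sup>T + \<Sigma>\<^sub>\<epsilon>\<close>, and the columns \<open>q\<^sub>k\<close> of \<open>Q\<close> are orthogonal with
  \<open>\<parallel>q\<^sub>k\<parallel>\<^sup>2 = p \<theta>\<^sub>k\<close>. The eigenvalue bounds are Weyl's inequalities: a dimension count gives a nonzero
  combination of \<open>\<phi>\<^sub>1, \<dots>, \<phi>\<^sub>j\<close> orthogonal to \<open>q\<^sub>1, \<dots>, q\<^sub>j\<^sub>-\<^sub>1\<close>, and one with the two families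
  exchanged, and one compares the quadratic form of \<open>\<Sigma>\<^sub>y\<close> with the other two there.

  For the eigenfunctions, let \<open>n\<close> be the normalized \<open>q\<^sub>j\<close> and write
  \<open>n = \<Sum>\<^sub>k\<^sub>\<le>\<^sub>r c\<^sub>k \<phi>\<^sub>k + w\<close> with \<open>w\<close> orthogonal to \<open>\<phi>\<^sub>1, \<dots>, \<phi>\<^sub>r\<close>. Testing
  \<open>\<Sigma>\<^sub>y n = p \<theta>\<^sub>j n + \<Sigma>\<^sub>\<epsilon> n\<close> against \<open>\<phi>\<^sub>k\<close> and against \<open>w\<close> bounds \<open>c\<^sub>k\<close> for
  \<open>k \<noteq> j\<close> and \<open>\<parallel>w\<parallel>\<close> by \<open>\<parallel>\<Sigma>\<^sub>\<epsilon>\<parallel>\<close> over a spectral gap of order \<open>p\<close>. On the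
  remainder \<open>w\<close> the quadratic form of \<open>\<Sigma>\<^sub>y\<close> is at most \<open>\<tau>\<^sub>r\<^sub>+\<^sub>1 \<parallel>w\<parallel>\<^sup>2\<close>, so neither
  completeness of \<open>L\<^sub>2\<close> nor of the eigenfunctions is needed.
\<close>

subsection \<open>Square-integrable functions\<close>

definition square_integrable :: "'a measure \<Rightarrow> ('a \<Rightarrow> real) \<Rightarrow> bool" where
  "square_integrable N f \<longleftrightarrow> f \<in> borel_measurable N \<and> integrable N (\<lambda>x. (f x)\<^sup>2)"

lemma square_integrableD:
  assumes "square_integrable N f"
  shows "f \<in> borel_measurable N" "integrable N (\<lambda>x. (f x)\<^sup>2)"
  using assms by (auto simp: square_integrable_def)

lemma square_integrable_mult:
  assumes "square_integrable N f" "square_integrable N g"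
  shows "integrable N (\<lambda>x. f x * g x)"
proof (rule Bochner_Integration.integrable_bound)
  show "integrable N (\<lambda>x. (f x)\<^sup>2 + (g x)\<^sup>2)"
    using assms by (auto simp: square_integrable_def)
  show "(\<lambda>x. f x * g x) \<in> borel_measurable N"
    using assms by (auto simp: square_integrable_def)
  have "\<bar>f x * g x\<bar> \<le> (f x)\<^sup>2 + (g x)\<^sup>2" for x
  proof -
    have "2 * \<bar>f x\<bar> * \<bar>g x\<bar> \<le> (f x)\<^sup>2 + (g x)\<^sup>2"
      using sum_squares_bound[of "\<bar>f x\<bar>" "\<bar>g x\<bar>"] by simp
    moreover have "0 \<le> \<bar>f x\<bar> * \<bar>g x\<bar>"
      by simp
    ultimately show ?thesis
      unfolding abs_mult by linarith
  qed
  then show "AE x in N. norm (f x * g x) \<le> norm ((f x)\<^sup>2 + (g x)\<^sup>2)"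
    by simp
qed

lemma square_integrable_add:
  assumes "square_integrable N f" "square_integrable N g"
  shows "square_integrable N (\<lambda>x. f x + g x)"
  using assms square_integrable_mult[OF assms]
  by (auto simp: square_integrable_def power2_sum mult.assoc)

lemma square_integrable_scale:
  assumes "square_integrable N f"
  shows "square_integrable N (\<lambda>x. c * f x)"
  using assms by (auto simp: square_integrable_def power_mult_distrib)

lemma square_integrable_sum:
  assumes "\<And>k. k \<in> I \<Longrightarrow> square_integrable N (f k)"
  shows "square_integrable N (\<lambda>x. \<Sum>k\<in>I. f k x)"
  using assms
proof (induction I rule: infinite_finite_induct)
  case (insert k I)
  then show ?case by (simp add: square_integrable_add)
qed (auto simp: square_integrable_def)

lemma square_integrable_cong:
  assumes "\<And>x. x \<in> space N \<Longrightarrow> f x = g x"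
  shows "square_integrable N f \<longleftrightarrow> square_integrable N g"
proof -
  have "f \<in> borel_measurable N \<longleftrightarrow> g \<in> borel_measurable N"
    using assms by (rule measurable_cong)
  moreover have "integrable N (\<lambda>x. (f x)\<^sup>2) \<longleftrightarrow> integrable N (\<lambda>x. (g x)\<^sup>2)"
    using assms by (intro Bochner_Integration.integrable_cong) auto
  ultimately show ?thesis
    by (simp add: square_integrable_def)
qed

text \<open>Shared by the two Cauchy-Schwarz inequalities, for scalar functions and for
  \<open>L2_inner\<close>, where the quadratic in t is the squared norm of f + t g. For C > 0 it is
  evaluated at its vertex \<open>- B / C\<close>; for C = 0 it is affine and can only stay
  nonnegative with slope 0.\<close>

lemma discriminant_bound:
  fixes A B C :: real
  assumes nonneg: "\<And>t. 0 \<le> A + 2 * t * B + t\<^sup>2 * C" and "0 \<le> C"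
  shows "B\<^sup>2 \<le> A * C"
proof (cases "C = 0")
  case True
  have "B = 0"
  proof (rule ccontr)
    assume "B \<noteq> 0"
    then show False
      \<comment> \<open>At this point the affine function takes the value -1.\<close>
      using nonneg[of "- (A + 1) / (2 * B)"] True by (simp add: field_simps)
  qed
  then show ?thesis using True by simp
next
  case False
  then have "0 \<le> (A + 2 * (- B / C) * B + (- B / C)\<^sup>2 * C) * C"
    using nonneg[of "- B / C"] \<open>0 \<le> C\<close> by (intro mult_nonneg_nonneg) auto
  also have "\<dots> = A * C - B\<^sup>2"
    using False by (simp add: field_simps power2_eq_square)
  finally show ?thesis by simp
qed

lemma Cauchy_Schwarz_LINT:
  assumes "square_integrable N f" "square_integrable N g"
  shows "(LINT x|N. f x * g x)\<^sup>2 \<le> (LINT x|N. (f x)\<^sup>2) * (LINT x|N. (g x)\<^sup>2)"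
proof (rule discriminant_bound)
  fix t :: real
  have "0 \<le> (LINT x|N. (f x + t * g x)\<^sup>2)"
    by simp
  also have "(LINT x|N. (f x + t * g x)\<^sup>2) =
      (LINT x|N. (f x)\<^sup>2 + 2 * t * (f x * g x) + t\<^sup>2 * (g x)\<^sup>2)"
    by (intro Bochner_Integration.integral_cong) (auto simp: power2_eq_square algebra_simps)
  also have "\<dots> = (LINT x|N. (f x)\<^sup>2) + 2 * t * (LINT x|N. f x * g x) + t\<^sup>2 * (LINT x|N. (g x)\<^sup>2)"
    using assms square_integrable_mult[OF assms] by (simp add: square_integrable_def)
  finally show "0 \<le> (LINT x|N. (f x)\<^sup>2) + 2 * t * (LINT x|N. f x * g x) + t\<^sup>2 * (LINT x|N. (g x)\<^sup>2)" .
qed simp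

lemma Cauchy_Schwarz_LINT_abs:
  assumes "square_integrable N f" "square_integrable N g"
  shows "\<bar>LINT x|N. f x * g x\<bar> \<le> sqrt (LINT x|N. (f x)\<^sup>2) * sqrt (LINT x|N. (g x)\<^sup>2)"
  using Cauchy_Schwarz_LINT[OF assms] by (simp add: real_le_rsqrt flip: real_sqrt_mult)

section \<open>Products of functions of separate variables\<close>

lemma (in pair_sigma_finite) integrable_tensor:
  fixes f g :: "_ \<Rightarrow> real"
  assumes f: "integrable M1 f" and g: "integrable M2 g"
  shows "integrable (M1 \<Otimes>\<^sub>M M2) (\<lambda>z. f (fst z) * g (snd z))"
proof (rule Fubini_integrable)
  have [measurable]: "f \<in> borel_measurable M1" "g \<in> borel_measurable M2"
    using f g by auto
  show "(\<lambda>z. f (fst z) * g (snd z)) \<in> borel_measurable (M1 \<Otimes>\<^sub>M M2)"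
    by measurable
qed (use f g in \<open>auto simp: abs_mult\<close>)

lemma (in pair_sigma_finite) integral_tensor:
  fixes f g :: "_ \<Rightarrow> real"
  assumes "integrable M1 f" "integrable M2 g"
  shows "(LINT z|(M1 \<Otimes>\<^sub>M M2). f (fst z) * g (snd z)) = (LINT x|M1. f x) * (LINT y|M2. g y)"
  using integral_fst'[OF integrable_tensor[OF assms]] by simp

lemma (in pair_sigma_finite) square_integrable_tensor:
  assumes f: "square_integrable M1 f" and g: "square_integrable M2 g"
  shows "square_integrable (M1 \<Otimes>\<^sub>M M2) (\<lambda>z. f (fst z) * g (snd z))"
proof -
  have [measurable]: "f \<in> borel_measurable M1" "g \<in> borel_measurable M2"
    using f g by (auto simp: square_integrable_def)
  have "(\<lambda>z. f (fst z) * g (snd z)) \<in> borel_measurable (M1 \<Otimes>\<^sub>M M2)"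
    by measurable
  then show ?thesis
    using integrable_tensor[of "\<lambda>x. (f x)\<^sup>2" "\<lambda>x. (g x)\<^sup>2"] f g
    by (auto simp: square_integrable_def power_mult_distrib)
qed

lemma sigma_finite_leb_Icc: "sigma_finite_measure (leb_Icc a b)"
  by (rule sigma_finite_measure_restrict_space) (auto intro: lborel.sigma_finite_measure_axioms)

interpretation leb_Icc: sigma_finite_measure "leb_Icc a b" for a b
  by (rule sigma_finite_leb_Icc)

interpretation leb_Icc_pair: pair_sigma_finite "leb_Icc a b" "leb_Icc a b" for a b ..

subsection \<open>The space of square-integrable vector functions\<close>

lemma L2_vec_iff:
  "f \<in> L2_vec a b p \<longleftrightarrow> (\<forall>i\<in>{1..p}. square_integrable (leb_Icc a b) (f i))"
  by (auto simp: L2_vec_def square_integrable_def)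

lemma L2_vecD: "f \<in> L2_vec a b p \<Longrightarrow> i \<in> {1..p} \<Longrightarrow> square_integrable (leb_Icc a b) (f i)"
  by (simp add: L2_vec_iff)

lemma L2_vec_lincomb:
  assumes "\<And>k. k \<in> I \<Longrightarrow> f k \<in> L2_vec a b p"
  shows "(\<lambda>i u. \<Sum>k\<in>I. x k * f k i u) \<in> L2_vec a b p"
  using assms unfolding L2_vec_iff by (auto intro!: square_integrable_sum square_integrable_scale)

lemma L2_inner_eq_sum:
  assumes "f \<in> L2_vec a b p" "g \<in> L2_vec a b p"
  shows "L2_inner a b p f g = (\<Sum>i\<in>{1..p}. LINT u|leb_Icc a b. f i u * g i u)"
  unfolding L2_inner_def
  using assms by (intro Bochner_Integration.integral_sum square_integrable_mult) (auto simp: L2_vec_iff)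

lemma L2_inner_commute: "L2_inner a b p f g = L2_inner a b p g f"
  by (simp add: L2_inner_def mult.commute)

lemma L2_inner_nonneg: "0 \<le> L2_inner a b p f f"
  by (auto simp: L2_inner_def intro!: Bochner_Integration.integral_nonneg sum_nonneg)

lemma L2_norm_nonneg: "0 \<le> L2_norm a b p f"
  by (simp add: L2_norm_def L2_inner_nonneg)

lemma L2_norm_power2: "(L2_norm a b p f)\<^sup>2 = L2_inner a b p f f"
  by (simp add: L2_norm_def L2_inner_nonneg)

section \<open>Bilinearity and Cauchy-Schwarz\<close>

lemma L2_inner_lincomb_left:
  assumes f: "\<And>k. k \<in> I \<Longrightarrow> f k \<in> L2_vec a b p" and g: "g \<in> L2_vec a b p"
  shows "L2_inner a b p (\<lambda>i u. \<Sum>k\<in>I. x k * f k i u) g = (\<Sum>k\<in>I. x k * L2_inner a b p (f k) g)"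
proof -
  have "L2_inner a b p (\<lambda>i u. \<Sum>k\<in>I. x k * f k i u) g =
      (\<Sum>i\<in>{1..p}. LINT u|leb_Icc a b. (\<Sum>k\<in>I. x k * (f k i u * g i u)))"
    by (subst L2_inner_eq_sum[OF L2_vec_lincomb[OF f] g]) (simp_all add: sum_distrib_right mult.assoc)
  also have "\<dots> = (\<Sum>i\<in>{1..p}. \<Sum>k\<in>I. x k * (LINT u|leb_Icc a b. f k i u * g i u))"
  proof (intro sum.cong refl)
    fix i assume "i \<in> {1..p}"
    then have "integrable (leb_Icc a b) (\<lambda>u. f k i u * g i u)" if "k \<in> I" for k
      using f[OF that] g by (intro square_integrable_mult) (auto simp: L2_vec_iff)
    then show "(LINT u|leb_Icc a b. (\<Sum>k\<in>I. x k * (f k i u * g i u))) =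
        (\<Sum>k\<in>I. x k * (LINT u|leb_Icc a b. f k i u * g i u))"
      by (subst Bochner_Integration.integral_sum) auto
  qed
  also have "\<dots> = (\<Sum>k\<in>I. \<Sum>i\<in>{1..p}. x k * (LINT u|leb_Icc a b. f k i u * g i u))"
    by (rule sum.swap)
  also have "\<dots> = (\<Sum>k\<in>I. x k * L2_inner a b p (f k) g)"
    using f g by (intro sum.cong refl) (simp add: L2_inner_eq_sum sum_distrib_left)
  finally show ?thesis .
qed

lemma L2_inner_lincomb_right:
  assumes "\<And>k. k \<in> I \<Longrightarrow> f k \<in> L2_vec a b p" "g \<in> L2_vec a b p"
  shows "L2_inner a b p g (\<lambda>i u. \<Sum>k\<in>I. x k * f k i u) = (\<Sum>k\<in>I. x k * L2_inner a b p g (f k))"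
  using L2_inner_lincomb_left[of I f a b p g x] assms by (simp add: L2_inner_commute)

lemma L2_vec_comb2:
  assumes "f \<in> L2_vec a b p" "g \<in> L2_vec a b p"
  shows "(\<lambda>i u. s * f i u + t * g i u) \<in> L2_vec a b p"
  using assms unfolding L2_vec_iff
  by (auto intro!: square_integrable_add square_integrable_scale)

lemma L2_inner_comb2_left:
  assumes "f \<in> L2_vec a b p" "g \<in> L2_vec a b p" "h \<in> L2_vec a b p"
  shows "L2_inner a b p (\<lambda>i u. s * f i u + t * g i u) h = s * L2_inner a b p f h + t * L2_inner a b p g h"
  \<comment> \<open>A combination of two functions is a sum over the index set of the two
    booleans.\<close>
  using L2_inner_lincomb_left[of UNIV "\<lambda>k. if k then f else g" a b p h "\<lambda>k. if k then s else t"] assms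
  by (simp add: UNIV_bool add.commute)

lemma L2_inner_comb2_right:
  assumes "f \<in> L2_vec a b p" "g \<in> L2_vec a b p" "h \<in> L2_vec a b p"
  shows "L2_inner a b p h (\<lambda>i u. s * f i u + t * g i u) = s * L2_inner a b p h f + t * L2_inner a b p h g"
  using L2_inner_comb2_left[of f a b p g h s t] assms by (simp add: L2_inner_commute)

lemma L2_inner_comb2_self:
  assumes "f \<in> L2_vec a b p" "g \<in> L2_vec a b p"
  shows "L2_inner a b p (\<lambda>i u. s * f i u + t * g i u) (\<lambda>i u. s * f i u + t * g i u) =
    s\<^sup>2 * L2_inner a b p f f + 2 * s * t * L2_inner a b p f g + t\<^sup>2 * L2_inner a b p g g"
  using assms
  by (simp add: L2_inner_comb2_left L2_inner_comb2_right L2_vec_comb2 L2_inner_commute[of a b p g f]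
      power2_eq_square algebra_simps)

lemma L2_Cauchy_Schwarz:
  assumes "f \<in> L2_vec a b p" "g \<in> L2_vec a b p"
  shows "\<bar>L2_inner a b p f g\<bar> \<le> L2_norm a b p f * L2_norm a b p g"
proof -
  have "(L2_inner a b p f g)\<^sup>2 \<le> L2_inner a b p f f * L2_inner a b p g g"
  proof (rule discriminant_bound)
    show "0 \<le> L2_inner a b p f f + 2 * t * L2_inner a b p f g + t\<^sup>2 * L2_inner a b p g g" for t
      using L2_inner_comb2_self[OF assms, of 1 t]
        L2_inner_nonneg[of a b p "\<lambda>i u. 1 * f i u + t * g i u"] by simp
  qed (rule L2_inner_nonneg)
  then show ?thesis
    unfolding L2_norm_def by (simp add: real_le_rsqrt flip: real_sqrt_mult)
qed

section \<open>Orthonormal families and projections\<close>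

definition L2_orthonormal :: "real \<Rightarrow> real \<Rightarrow> nat \<Rightarrow> 'k set \<Rightarrow> ('k \<Rightarrow> nat \<Rightarrow> real \<Rightarrow> real) \<Rightarrow> bool" where
  "L2_orthonormal a b p I e \<longleftrightarrow> (\<forall>k\<in>I. e k \<in> L2_vec a b p) \<and>
    (\<forall>k\<in>I. \<forall>l\<in>I. L2_inner a b p (e k) (e l) = (if k = l then 1 else 0))"

lemma L2_orthonormal_subset: "L2_orthonormal a b p I e \<Longrightarrow> J \<subseteq> I \<Longrightarrow> L2_orthonormal a b p J e"
  unfolding L2_orthonormal_def by blast

lemma L2_inner_lincomb_orthonormal:
  assumes "finite I" "L2_orthonormal a b p I e" "l \<in> I"
  shows "L2_inner a b p (e l) (\<lambda>i u. \<Sum>k\<in>I. x k * e k i u) = x l"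
proof -
  have "L2_inner a b p (e l) (\<lambda>i u. \<Sum>k\<in>I. x k * e k i u) = (\<Sum>k\<in>I. x k * L2_inner a b p (e l) (e k))"
    using assms by (intro L2_inner_lincomb_right) (auto simp: L2_orthonormal_def)
  also have "\<dots> = (\<Sum>k\<in>I. if k = l then x k else 0)"
    using assms by (intro sum.cong) (auto simp: L2_orthonormal_def)
  finally show ?thesis
    using assms by simp
qed

lemma L2_inner_lincomb_orthonormal_self:
  assumes "finite I" "L2_orthonormal a b p I e"
  shows "L2_inner a b p (\<lambda>i u. \<Sum>k\<in>I. x k * e k i u) (\<lambda>i u. \<Sum>k\<in>I. x k * e k i u) = (\<Sum>k\<in>I. (x k)\<^sup>2)"
proof -
  have mem: "e k \<in> L2_vec a b p" if "k \<in> I" for k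
    using assms that by (auto simp: L2_orthonormal_def)
  show ?thesis
    using assms
    by (subst L2_inner_lincomb_left[OF mem L2_vec_lincomb[OF mem]])
       (auto simp: L2_inner_lincomb_orthonormal power2_eq_square)
qed

text \<open>Pythagoras for f minus its projection onto the span of the e_k. The last fact holds
  because the projection is orthogonal to w; the third yields Bessel's inequality. The coefficients
  \<open>1\<close> and \<open>(-1)\<close> are written out so that the two-term combination lemmas
  match.\<close>

lemma L2_residual:
  assumes I: "finite I" "L2_orthonormal a b p I e" and f: "f \<in> L2_vec a b p"
  defines "w \<equiv> (\<lambda>i u. 1 * f i u + (-1) * (\<Sum>k\<in>I. L2_inner a b p (e k) f * e k i u))"
  shows "w \<in> L2_vec a b p"
    and "\<And>l. l \<in> I \<Longrightarrow> L2_inner a b p (e l) w = 0"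
    and "L2_inner a b p w w = L2_inner a b p f f - (\<Sum>k\<in>I. (L2_inner a b p (e k) f)\<^sup>2)"
    and "L2_inner a b p w f = L2_inner a b p w w"
proof -
  define h where "h = (\<lambda>i u. \<Sum>k\<in>I. L2_inner a b p (e k) f * e k i u)"
  have e: "e k \<in> L2_vec a b p" if "k \<in> I" for k
    using I that by (auto simp: L2_orthonormal_def)
  have h: "h \<in> L2_vec a b p"
    unfolding h_def using e by (rule L2_vec_lincomb)
  have w: "w = (\<lambda>i u. 1 * f i u + (-1) * h i u)"
    by (simp add: w_def h_def)
  show wL: "w \<in> L2_vec a b p"
    unfolding w using f h by (rule L2_vec_comb2)
  show "L2_inner a b p (e l) w = 0" if "l \<in> I" for l
    unfolding w using L2_inner_comb2_right[OF f h e[OF that], of 1 "-1"]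
      L2_inner_lincomb_orthonormal[OF I that, of "\<lambda>k. L2_inner a b p (e k) f"]
    by (simp flip: h_def)
  have hh: "L2_inner a b p h h = (\<Sum>k\<in>I. (L2_inner a b p (e k) f)\<^sup>2)"
    unfolding h_def by (rule L2_inner_lincomb_orthonormal_self[OF I])
  have hf: "L2_inner a b p h f = (\<Sum>k\<in>I. (L2_inner a b p (e k) f)\<^sup>2)"
    unfolding h_def by (subst L2_inner_lincomb_left[OF e f]) (auto simp: power2_eq_square)
  show ww: "L2_inner a b p w w = L2_inner a b p f f - (\<Sum>k\<in>I. (L2_inner a b p (e k) f)\<^sup>2)"
    unfolding w using L2_inner_comb2_self[OF f h, of 1 "-1"] hh hf
    by (simp add: L2_inner_commute[of a b p f h])
  show "L2_inner a b p w f = L2_inner a b p w w"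
    unfolding ww unfolding w using L2_inner_comb2_left[OF f h f, of 1 "-1"] hf by simp
qed

lemma L2_Bessel:
  assumes "finite I" "L2_orthonormal a b p I e" "f \<in> L2_vec a b p"
  shows "(\<Sum>k\<in>I. (L2_inner a b p (e k) f)\<^sup>2) \<le> L2_inner a b p f f"
  using L2_residual(3)[OF assms] L2_inner_nonneg
  by (metis (no_types, lifting) diff_ge_0_iff_ge)

subsection \<open>Integral operators\<close>

text \<open>These are the Hilbert-Schmidt kernels. Covariance functions of random functions with
  finite mean squared norm belong to this class, and it is closed under the sums and differences
  formed below.\<close>

definition square_integrable_kernel ::
  "real \<Rightarrow> real \<Rightarrow> nat \<Rightarrow> (nat \<Rightarrow> nat \<Rightarrow> real \<Rightarrow> real \<Rightarrow> real) \<Rightarrow> bool" where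
  "square_integrable_kernel a b p K \<longleftrightarrow> (\<forall>i\<in>{1..p}. \<forall>j\<in>{1..p}.
    square_integrable (leb_Icc a b \<Otimes>\<^sub>M leb_Icc a b) (\<lambda>z. K i j (fst z) (snd z)))"

text \<open>
  \<open>\<langle>f, K g\<rangle>\<close> as an integral over the square, which makes it bilinear without
  any almost-everywhere argument about sections of the kernel.
\<close>

definition kernel_form ::
  "real \<Rightarrow> real \<Rightarrow> nat \<Rightarrow> (nat \<Rightarrow> nat \<Rightarrow> real \<Rightarrow> real \<Rightarrow> real) \<Rightarrow>
    (nat \<Rightarrow> real \<Rightarrow> real) \<Rightarrow> (nat \<Rightarrow> real \<Rightarrow> real) \<Rightarrow> real" where
  "kernel_form a b p K f g = (\<Sum>i\<in>{1..p}. \<Sum>j\<in>{1..p}.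
    LINT z|(leb_Icc a b \<Otimes>\<^sub>M leb_Icc a b). K i j (fst z) (snd z) * (f i (fst z) * g j (snd z)))"

lemma kernel_form_integrable:
  assumes "square_integrable_kernel a b p K" "f \<in> L2_vec a b p" "g \<in> L2_vec a b p"
    and "i \<in> {1..p}" "j \<in> {1..p}"
  shows "integrable (leb_Icc a b \<Otimes>\<^sub>M leb_Icc a b)
    (\<lambda>z. K i j (fst z) (snd z) * (f i (fst z) * g j (snd z)))"
  using assms
  by (intro square_integrable_mult leb_Icc_pair.square_integrable_tensor)
     (auto simp: square_integrable_kernel_def L2_vec_iff)

text \<open>Cauchy-Schwarz on the square, entry by entry, where the norm of f_i(u) g_j(v)
  factorizes. The constant is crude, but it shows that the supremum defining the operator norm is
  finite, and that convergence of kernels in L2 carries over to their forms.\<close>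

lemma kernel_form_bound:
  assumes K: "square_integrable_kernel a b p K" and fg: "f \<in> L2_vec a b p" "g \<in> L2_vec a b p"
  shows "\<bar>kernel_form a b p K f g\<bar> \<le> (\<Sum>i\<in>{1..p}. \<Sum>j\<in>{1..p}.
      sqrt (LINT z|(leb_Icc a b \<Otimes>\<^sub>M leb_Icc a b). (K i j (fst z) (snd z))\<^sup>2)) *
    (L2_norm a b p f * L2_norm a b p g)"
proof -
  have comp: "sqrt (LINT u|leb_Icc a b. (h i u)\<^sup>2) \<le> L2_norm a b p h"
    if "h \<in> L2_vec a b p" "i \<in> {1..p}" for h i
  proof -
    have "(LINT u|leb_Icc a b. (h i u)\<^sup>2) \<le> (\<Sum>i\<in>{1..p}. LINT u|leb_Icc a b. (h i u)\<^sup>2)"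
      using that by (intro member_le_sum) auto
    also have "\<dots> = L2_inner a b p h h"
      using that by (simp add: L2_inner_eq_sum power2_eq_square)
    finally show ?thesis
      by (simp add: L2_norm_def)
  qed
  have "\<bar>LINT z|(leb_Icc a b \<Otimes>\<^sub>M leb_Icc a b). K i j (fst z) (snd z) * (f i (fst z) * g j (snd z))\<bar>
      \<le> sqrt (LINT z|(leb_Icc a b \<Otimes>\<^sub>M leb_Icc a b). (K i j (fst z) (snd z))\<^sup>2) *
        (L2_norm a b p f * L2_norm a b p g)" (is "_ \<le> ?k * _")
    if ij: "i \<in> {1..p}" "j \<in> {1..p}" for i j
  proof -
    have sq: "square_integrable (leb_Icc a b) (f i)" "square_integrable (leb_Icc a b) (g j)"
      using fg ij by (auto simp: L2_vec_iff)
    have "\<bar>LINT z|(leb_Icc a b \<Otimes>\<^sub>M leb_Icc a b). K i j (fst z) (snd z) * (f i (fst z) * g j (snd z))\<bar>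
        \<le> ?k * sqrt (LINT z|(leb_Icc a b \<Otimes>\<^sub>M leb_Icc a b). (f i (fst z) * g j (snd z))\<^sup>2)"
      using K ij sq
      by (intro Cauchy_Schwarz_LINT_abs leb_Icc_pair.square_integrable_tensor)
         (auto simp: square_integrable_kernel_def)
    also have "sqrt (LINT z|(leb_Icc a b \<Otimes>\<^sub>M leb_Icc a b). (f i (fst z) * g j (snd z))\<^sup>2) =
        sqrt (LINT u|leb_Icc a b. (f i u)\<^sup>2) * sqrt (LINT v|leb_Icc a b. (g j v)\<^sup>2)"
      using leb_Icc_pair.integral_tensor[OF square_integrableD(2)[OF sq(1)] square_integrableD(2)[OF sq(2)]]
      by (simp add: power_mult_distrib real_sqrt_mult)
    also have "?k * \<dots> \<le> ?k * (L2_norm a b p f * L2_norm a b p g)"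
      using fg ij by (intro mult_left_mono mult_mono comp L2_norm_nonneg) auto
    finally show ?thesis .
  qed
  then show ?thesis
    unfolding kernel_form_def sum_distrib_right
    by (intro order_trans[OF sum_abs] sum_mono) auto
qed

section \<open>Algebra of the kernel form\<close>

lemma kernel_form_lincomb_right:
  assumes K: "square_integrable_kernel a b p K" and f: "f \<in> L2_vec a b p"
    and g: "\<And>k. k \<in> I \<Longrightarrow> g k \<in> L2_vec a b p"
  shows "kernel_form a b p K f (\<lambda>i u. \<Sum>k\<in>I. x k * g k i u) = (\<Sum>k\<in>I. x k * kernel_form a b p K f (g k))"
proof -
  have "(LINT z|(leb_Icc a b \<Otimes>\<^sub>M leb_Icc a b).
        K i j (fst z) (snd z) * (f i (fst z) * (\<Sum>k\<in>I. x k * g k j (snd z)))) =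
      (\<Sum>k\<in>I. x k * (LINT z|(leb_Icc a b \<Otimes>\<^sub>M leb_Icc a b).
        K i j (fst z) (snd z) * (f i (fst z) * g k j (snd z))))"
    if ij: "i \<in> {1..p}" "j \<in> {1..p}" for i j
  proof -
    have "(LINT z|(leb_Icc a b \<Otimes>\<^sub>M leb_Icc a b).
        K i j (fst z) (snd z) * (f i (fst z) * (\<Sum>k\<in>I. x k * g k j (snd z)))) =
      (LINT z|(leb_Icc a b \<Otimes>\<^sub>M leb_Icc a b). (\<Sum>k\<in>I. x k *
        (K i j (fst z) (snd z) * (f i (fst z) * g k j (snd z)))))"
      by (simp add: sum_distrib_left mult_ac)
    also have "\<dots> = (\<Sum>k\<in>I. LINT z|(leb_Icc a b \<Otimes>\<^sub>M leb_Icc a b). x k *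
        (K i j (fst z) (snd z) * (f i (fst z) * g k j (snd z))))"
      using ij by (intro Bochner_Integration.integral_sum integrable_mult_right kernel_form_integrable[OF K f g])
    finally show ?thesis by simp
  qed
  then have "kernel_form a b p K f (\<lambda>i u. \<Sum>k\<in>I. x k * g k i u) =
      (\<Sum>i\<in>{1..p}. \<Sum>j\<in>{1..p}. \<Sum>k\<in>I. x k * (LINT z|(leb_Icc a b \<Otimes>\<^sub>M leb_Icc a b).
        K i j (fst z) (snd z) * (f i (fst z) * g k j (snd z))))"
    unfolding kernel_form_def by (intro sum.cong refl)
  also have "\<dots> = (\<Sum>i\<in>{1..p}. \<Sum>k\<in>I. \<Sum>j\<in>{1..p}. x k * (LINT z|(leb_Icc a b \<Otimes>\<^sub>M leb_Icc a b).
        K i j (fst z) (snd z) * (f i (fst z) * g k j (snd z))))"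
    by (intro sum.cong refl sum.swap)
  also have "\<dots> = (\<Sum>k\<in>I. x k * kernel_form a b p K f (g k))"
    unfolding kernel_form_def sum_distrib_left by (rule sum.swap)
  finally show ?thesis .
qed

lemma kernel_form_comb2_right:
  assumes "square_integrable_kernel a b p K" "f \<in> L2_vec a b p" "g \<in> L2_vec a b p" "h \<in> L2_vec a b p"
  shows "kernel_form a b p K f (\<lambda>i u. s * g i u + t * h i u) =
    s * kernel_form a b p K f g + t * kernel_form a b p K f h"
  using kernel_form_lincomb_right[of a b p K f UNIV "\<lambda>k. if k then g else h" "\<lambda>k. if k then s else t"] assms
  by (simp add: UNIV_bool add.commute)

text \<open>Exchanging the two coordinates of the square, then the two summation indices, swaps the
  roles of f and g.\<close>

lemma kernel_form_commute:
  assumes K: "square_integrable_kernel a b p K"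
    and sym: "\<And>i j u v. i \<in> {1..p} \<Longrightarrow> j \<in> {1..p} \<Longrightarrow> u \<in> {a..b} \<Longrightarrow> v \<in> {a..b} \<Longrightarrow> K i j u v = K j i v u"
    and fg: "f \<in> L2_vec a b p" "g \<in> L2_vec a b p"
  shows "kernel_form a b p K f g = kernel_form a b p K g f"
proof -
  have "(LINT z|(leb_Icc a b \<Otimes>\<^sub>M leb_Icc a b). K i j (fst z) (snd z) * (f i (fst z) * g j (snd z))) =
      (LINT z|(leb_Icc a b \<Otimes>\<^sub>M leb_Icc a b). K j i (fst z) (snd z) * (g j (fst z) * f i (snd z)))"
    if ij: "i \<in> {1..p}" "j \<in> {1..p}" for i j
  proof -
    have "(LINT z|(leb_Icc a b \<Otimes>\<^sub>M leb_Icc a b). K i j (fst z) (snd z) * (f i (fst z) * g j (snd z))) =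
        (LINT (u, v)|(leb_Icc a b \<Otimes>\<^sub>M leb_Icc a b). K i j v u * (f i v * g j u))"
      using leb_Icc_pair.integral_product_swap[OF borel_measurable_integrable[OF kernel_form_integrable[OF K fg ij]]]
      by (simp add: case_prod_beta)
    also have "\<dots> = (LINT z|(leb_Icc a b \<Otimes>\<^sub>M leb_Icc a b). K j i (fst z) (snd z) * (g j (fst z) * f i (snd z)))"
      using sym[OF ij] by (intro Bochner_Integration.integral_cong) (auto simp: space_pair_measure)
    finally show ?thesis .
  qed
  then have "kernel_form a b p K f g = (\<Sum>i\<in>{1..p}. \<Sum>j\<in>{1..p}.
      LINT z|(leb_Icc a b \<Otimes>\<^sub>M leb_Icc a b). K j i (fst z) (snd z) * (g j (fst z) * f i (snd z)))"
    unfolding kernel_form_def by (intro sum.cong refl)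
  also have "\<dots> = kernel_form a b p K g f"
    unfolding kernel_form_def by (rule sum.swap)
  finally show ?thesis .
qed

lemma kernel_form_cong:
  assumes "\<And>i j u v. i \<in> {1..p} \<Longrightarrow> j \<in> {1..p} \<Longrightarrow> u \<in> {a..b} \<Longrightarrow> v \<in> {a..b} \<Longrightarrow> K i j u v = K' i j u v"
  shows "kernel_form a b p K f g = kernel_form a b p K' f g"
  unfolding kernel_form_def using assms
  by (intro sum.cong refl Bochner_Integration.integral_cong) (auto simp: space_pair_measure)

lemma kernel_form_add:
  assumes "square_integrable_kernel a b p K" "square_integrable_kernel a b p K'"
    and "f \<in> L2_vec a b p" "g \<in> L2_vec a b p"
  shows "kernel_form a b p (\<lambda>i j u v. K i j u v + K' i j u v) f g =
    kernel_form a b p K f g + kernel_form a b p K' f g"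
  unfolding kernel_form_def sum.distrib[symmetric]
  using kernel_form_integrable[OF assms(1,3,4)] kernel_form_integrable[OF assms(2,3,4)]
  by (intro sum.cong refl) (simp add: distrib_right)

lemma square_integrable_kernel_add:
  assumes "square_integrable_kernel a b p K" "square_integrable_kernel a b p K'"
  shows "square_integrable_kernel a b p (\<lambda>i j u v. K i j u v + K' i j u v)"
  using assms unfolding square_integrable_kernel_def by (auto intro!: square_integrable_add)

lemma square_integrable_kernel_diff:
  assumes "square_integrable_kernel a b p K" "square_integrable_kernel a b p K'"
  shows "square_integrable_kernel a b p (\<lambda>i j u v. K i j u v - K' i j u v)"
proof -
  have "square_integrable N (\<lambda>x. f x - g x)" if "square_integrable N f" "square_integrable N g"
    for N :: "(real \<times> real) measure" and f g
    using square_integrable_add[OF that(1) square_integrable_scale[OF that(2), of "-1"]] by simp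
  then show ?thesis
    using assms unfolding square_integrable_kernel_def by blast
qed

lemma square_integrable_kernel_finite_rank:
  assumes "\<And>k. k \<in> I \<Longrightarrow> q k \<in> L2_vec a b p"
  shows "square_integrable_kernel a b p (\<lambda>i j u v. \<Sum>k\<in>I. c k * q k i u * q k j v)"
  using assms unfolding square_integrable_kernel_def mult.assoc
  by (auto intro!: square_integrable_sum square_integrable_scale leb_Icc_pair.square_integrable_tensor
      simp: L2_vec_iff)

text \<open>Each summand of the integrand is a function of the first coordinate times a function of
  the second, so its integral over the square is a product of two integrals.\<close>

lemma kernel_form_finite_rank:
  assumes q: "\<And>k. k \<in> I \<Longrightarrow> q k \<in> L2_vec a b p" and fg: "f \<in> L2_vec a b p" "g \<in> L2_vec a b p"
  shows "kernel_form a b p (\<lambda>i j u v. \<Sum>k\<in>I. c k * q k i u * q k j v) f g =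
    (\<Sum>k\<in>I. c k * L2_inner a b p (q k) f * L2_inner a b p (q k) g)"
proof -
  have int: "integrable (leb_Icc a b) (\<lambda>u. q k i u * h i u)"
    if "k \<in> I" "i \<in> {1..p}" "h \<in> L2_vec a b p" for k i h
    using q[OF that(1)] that by (intro square_integrable_mult) (auto simp: L2_vec_iff)
  have "(LINT z|(leb_Icc a b \<Otimes>\<^sub>M leb_Icc a b).
        (\<Sum>k\<in>I. c k * q k i (fst z) * q k j (snd z)) * (f i (fst z) * g j (snd z))) =
      (\<Sum>k\<in>I. c k * ((LINT u|leb_Icc a b. q k i u * f i u) * (LINT v|leb_Icc a b. q k j v * g j v)))"
    if ij: "i \<in> {1..p}" "j \<in> {1..p}" for i j
  proof -
    have "(LINT z|(leb_Icc a b \<Otimes>\<^sub>M leb_Icc a b).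
        (\<Sum>k\<in>I. c k * q k i (fst z) * q k j (snd z)) * (f i (fst z) * g j (snd z))) =
      (LINT z|(leb_Icc a b \<Otimes>\<^sub>M leb_Icc a b).
        (\<Sum>k\<in>I. c k * ((q k i (fst z) * f i (fst z)) * (q k j (snd z) * g j (snd z)))))"
      unfolding sum_distrib_right by (simp add: mult_ac)
    also have "\<dots> = (\<Sum>k\<in>I. LINT z|(leb_Icc a b \<Otimes>\<^sub>M leb_Icc a b).
        c k * ((q k i (fst z) * f i (fst z)) * (q k j (snd z) * g j (snd z))))"
      using ij fg
      by (intro Bochner_Integration.integral_sum integrable_mult_right)
         (rule leb_Icc_pair.integrable_tensor; rule int; simp)
    also have "\<dots> = (\<Sum>k\<in>I. c k * ((LINT u|leb_Icc a b. q k i u * f i u) * (LINT v|leb_Icc a b. q k j v * g j v)))"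
      using leb_Icc_pair.integral_tensor[OF int int] ij fg by simp
    finally show ?thesis .
  qed
  then have "kernel_form a b p (\<lambda>i j u v. \<Sum>k\<in>I. c k * q k i u * q k j v) f g =
    (\<Sum>i\<in>{1..p}. \<Sum>j\<in>{1..p}. \<Sum>k\<in>I.
      c k * ((LINT u|leb_Icc a b. q k i u * f i u) * (LINT v|leb_Icc a b. q k j v * g j v)))"
    unfolding kernel_form_def by (intro sum.cong refl)
  also have "\<dots> = (\<Sum>i\<in>{1..p}. \<Sum>k\<in>I. \<Sum>j\<in>{1..p}.
      c k * ((LINT u|leb_Icc a b. q k i u * f i u) * (LINT v|leb_Icc a b. q k j v * g j v)))"
    by (intro sum.cong refl sum.swap)
  also have "\<dots> = (\<Sum>k\<in>I. \<Sum>i\<in>{1..p}. \<Sum>j\<in>{1..p}.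
      c k * ((LINT u|leb_Icc a b. q k i u * f i u) * (LINT v|leb_Icc a b. q k j v * g j v)))"
    by (rule sum.swap)
  also have "\<dots> = (\<Sum>k\<in>I. c k * L2_inner a b p (q k) f * L2_inner a b p (q k) g)"
    using q fg by (intro sum.cong refl) (simp add: L2_inner_eq_sum sum_product mult.assoc flip: sum_distrib_left)
  finally show ?thesis .
qed

text \<open>Links the pointwise integral operator with the form on the square by Fubini. All later
  arguments go through the form; the operator itself returns only in the operator norm and in the
  eigenvalue equation.\<close>

lemma kernel_op_L2:
  assumes K: "square_integrable_kernel a b p K" and g: "g \<in> L2_vec a b p"
  shows "kernel_op a b p K g \<in> L2_vec a b p"
    and "f \<in> L2_vec a b p \<Longrightarrow> L2_inner a b p f (kernel_op a b p K g) = kernel_form a b p K f g"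
proof -
  have Km: "(\<lambda>z. K i j (fst z) (snd z)) \<in> borel_measurable (leb_Icc a b \<Otimes>\<^sub>M leb_Icc a b)"
    if "i \<in> {1..p}" "j \<in> {1..p}" for i j
    using K that by (auto simp: square_integrable_kernel_def square_integrable_def)
  have gm: "g j \<in> borel_measurable (leb_Icc a b)" if "j \<in> {1..p}" for j
    using g that by (auto simp: L2_vec_iff square_integrable_def)
  have meas: "kernel_op a b p K g i \<in> borel_measurable (leb_Icc a b)" if i: "i \<in> {1..p}" for i
  proof -
    have "(\<lambda>z. \<Sum>j\<in>{1..p}. K i j (fst z) (snd z) * g j (snd z)) \<in> borel_measurable (leb_Icc a b \<Otimes>\<^sub>M leb_Icc a b)"
      using Km[OF i] gm by (intro borel_measurable_sum borel_measurable_times measurable_compose[OF measurable_snd]) auto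
    then show ?thesis
      unfolding kernel_op_def
      by (intro leb_Icc.borel_measurable_lebesgue_integral) (simp add: case_prod_beta)
  qed
  \<comment> \<open>For the u in this set of full measure, \<open>kernel_op\<close> splits into the
    sum over j of separate integrals; elsewhere an integral may take its default value 0 and the
    splitting may fail.\<close>
  have sections: "AE u in leb_Icc a b. \<forall>j\<in>{1..p}. square_integrable (leb_Icc a b) (K i j u)" if i: "i \<in> {1..p}" for i
  proof (intro AE_finite_allI)
    fix j assume j: "j \<in> {1..p}"
    have "AE u in leb_Icc a b. integrable (leb_Icc a b) (\<lambda>v. (K i j u v)\<^sup>2)"
      using K i j leb_Icc_pair.AE_integrable_fst'[of a b "\<lambda>z. (K i j (fst z) (snd z))\<^sup>2"]
      by (auto simp: square_integrable_kernel_def square_integrable_def)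
    then show "AE u in leb_Icc a b. square_integrable (leb_Icc a b) (K i j u)"
    proof (rule AE_mp)
      show "AE u in leb_Icc a b. integrable (leb_Icc a b) (\<lambda>v. (K i j u v)\<^sup>2) \<longrightarrow>
          square_integrable (leb_Icc a b) (K i j u)"
        using measurable_compose[OF measurable_Pair1' Km[OF i j]]
        by (intro AE_I2) (auto simp: square_integrable_def)
    qed
  qed simp
  show opL: "kernel_op a b p K g \<in> L2_vec a b p"
    unfolding L2_vec_iff
  proof
    fix i assume i: "i \<in> {1..p}"
    \<comment> \<open>\<open>B u * G\<close> dominates the square of the operator's value by two
      uses of Cauchy-Schwarz, first in v for each j and then in the sum over j. \<open>B\<close> is
      integrable because the entries of row i are square integrable.\<close>
    define B where "B u = (\<Sum>j\<in>{1..p}. LINT v|leb_Icc a b. (K i j u v)\<^sup>2)" for u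
    define G where "G = (\<Sum>j\<in>{1..p}. LINT v|leb_Icc a b. (g j v)\<^sup>2)"
    have intB: "integrable (leb_Icc a b) (\<lambda>u. B u * G)"
      unfolding B_def
    proof (intro integrable_mult_left Bochner_Integration.integrable_sum)
      fix j assume "j \<in> {1..p}"
      then show "integrable (leb_Icc a b) (\<lambda>u. LINT v|leb_Icc a b. (K i j u v)\<^sup>2)"
        using K i leb_Icc_pair.integrable_fst'[of a b "\<lambda>z. (K i j (fst z) (snd z))\<^sup>2"]
        by (auto simp: square_integrable_kernel_def square_integrable_def)
    qed
    have "AE u in leb_Icc a b. (kernel_op a b p K g i u)\<^sup>2 \<le> B u * G"
      using sections[OF i]
    proof eventually_elim
      fix u assume sec: "\<forall>j\<in>{1..p}. square_integrable (leb_Icc a b) (K i j u)"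
      have "kernel_op a b p K g i u = (\<Sum>j\<in>{1..p}. LINT v|leb_Icc a b. K i j u v * g j v)"
        unfolding kernel_op_def using sec g
        by (intro Bochner_Integration.integral_sum square_integrable_mult) (auto simp: L2_vec_iff)
      then have "\<bar>kernel_op a b p K g i u\<bar> \<le> (\<Sum>j\<in>{1..p}. \<bar>LINT v|leb_Icc a b. K i j u v * g j v\<bar>)"
        by (metis sum_abs)
      also have "\<dots> \<le> (\<Sum>j\<in>{1..p}. \<bar>sqrt (LINT v|leb_Icc a b. (K i j u v)\<^sup>2)\<bar> * \<bar>sqrt (LINT v|leb_Icc a b. (g j v)\<^sup>2)\<bar>)"
      proof (intro sum_mono)
        fix j assume "j \<in> {1..p}"
        then have "square_integrable (leb_Icc a b) (K i j u)" "square_integrable (leb_Icc a b) (g j)"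
          using sec g by (auto simp: L2_vec_iff)
        from Cauchy_Schwarz_LINT_abs[OF this]
        show "\<bar>LINT v|leb_Icc a b. K i j u v * g j v\<bar> \<le>
            \<bar>sqrt (LINT v|leb_Icc a b. (K i j u v)\<^sup>2)\<bar> * \<bar>sqrt (LINT v|leb_Icc a b. (g j v)\<^sup>2)\<bar>"
          by simp
      qed
      finally have "\<bar>kernel_op a b p K g i u\<bar>\<^sup>2 \<le> (\<Sum>j\<in>{1..p}. \<bar>sqrt (LINT v|leb_Icc a b. (K i j u v)\<^sup>2)\<bar> * \<bar>sqrt (LINT v|leb_Icc a b. (g j v)\<^sup>2)\<bar>)\<^sup>2"
        by (intro power_mono) auto
      also have "\<dots> \<le> B u * G"
        using Cauchy_Schwarz_ineq_sum[of "\<lambda>j. \<bar>sqrt (LINT v|leb_Icc a b. (K i j u v)\<^sup>2)\<bar>"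
            "\<lambda>j. \<bar>sqrt (LINT v|leb_Icc a b. (g j v)\<^sup>2)\<bar>" "{1..p}"]
        by (simp add: B_def G_def)
      finally show "(kernel_op a b p K g i u)\<^sup>2 \<le> B u * G"
        by simp
    qed
    then have bound: "AE u in leb_Icc a b. norm ((kernel_op a b p K g i u)\<^sup>2) \<le> norm (B u * G)"
    proof eventually_elim
      case (elim u)
      then show ?case
        using abs_ge_self[of "B u * G"] unfolding real_norm_def abs_power2 by linarith
    qed
    have "integrable (leb_Icc a b) (\<lambda>u. (kernel_op a b p K g i u)\<^sup>2)"
      by (rule Bochner_Integration.integrable_bound[OF intB borel_measurable_power[OF meas[OF i]] bound])
    then show "square_integrable (leb_Icc a b) (kernel_op a b p K g i)"
      using meas[OF i] by (simp add: square_integrable_def)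
  qed
  show "L2_inner a b p f (kernel_op a b p K g) = kernel_form a b p K f g" if f: "f \<in> L2_vec a b p"
  proof -
    have "(LINT u|leb_Icc a b. f i u * kernel_op a b p K g i u) =
        (\<Sum>j\<in>{1..p}. LINT z|(leb_Icc a b \<Otimes>\<^sub>M leb_Icc a b). K i j (fst z) (snd z) * (f i (fst z) * g j (snd z)))"
      if i: "i \<in> {1..p}" for i
    proof -
      have int: "integrable (leb_Icc a b \<Otimes>\<^sub>M leb_Icc a b) (\<lambda>z. K i j (fst z) (snd z) * (f i (fst z) * g j (snd z)))"
        if "j \<in> {1..p}" for j
        by (rule kernel_form_integrable[OF K f g i that])
      have "(\<Sum>j\<in>{1..p}. LINT z|(leb_Icc a b \<Otimes>\<^sub>M leb_Icc a b). K i j (fst z) (snd z) * (f i (fst z) * g j (snd z)))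
        = (\<Sum>j\<in>{1..p}. LINT u|leb_Icc a b. LINT v|leb_Icc a b. K i j u v * (f i u * g j v))"
        using leb_Icc_pair.integral_fst'[OF int] by simp
      also have "\<dots> = (LINT u|leb_Icc a b. (\<Sum>j\<in>{1..p}. LINT v|leb_Icc a b. K i j u v * (f i u * g j v)))"
        using leb_Icc_pair.integrable_fst'[OF int]
        by (intro Bochner_Integration.integral_sum[symmetric]) simp
      also have "\<dots> = (LINT u|leb_Icc a b. f i u * kernel_op a b p K g i u)"
      proof (rule integral_cong_AE)
        show "(\<lambda>u. \<Sum>j\<in>{1..p}. LINT v|leb_Icc a b. K i j u v * (f i u * g j v)) \<in> borel_measurable (leb_Icc a b)"
          using leb_Icc_pair.integrable_fst'[OF int] by (intro borel_measurable_sum) auto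
        show "(\<lambda>u. f i u * kernel_op a b p K g i u) \<in> borel_measurable (leb_Icc a b)"
          using square_integrableD(1)[OF L2_vecD[OF f i]] meas[OF i] by simp
        show "AE u in leb_Icc a b. (\<Sum>j\<in>{1..p}. LINT v|leb_Icc a b. K i j u v * (f i u * g j v)) =
            f i u * kernel_op a b p K g i u"
          using sections[OF i]
        proof eventually_elim
          fix u assume sec: "\<forall>j\<in>{1..p}. square_integrable (leb_Icc a b) (K i j u)"
          have "kernel_op a b p K g i u = (\<Sum>j\<in>{1..p}. LINT v|leb_Icc a b. K i j u v * g j v)"
            unfolding kernel_op_def using sec g
            by (intro Bochner_Integration.integral_sum square_integrable_mult) (auto simp: L2_vec_iff)
          moreover have "(LINT v|leb_Icc a b. K i j u v * (f i u * g j v)) =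
              f i u * (LINT v|leb_Icc a b. K i j u v * g j v)" for j
            unfolding mult.left_commute[of "K i j u _"] by simp
          ultimately show "(\<Sum>j\<in>{1..p}. LINT v|leb_Icc a b. K i j u v * (f i u * g j v)) =
              f i u * kernel_op a b p K g i u"
            by (simp only: sum_distrib_left)
        qed
      qed
      finally show ?thesis by simp
    qed
    then show ?thesis
      using f opL by (simp add: L2_inner_eq_sum kernel_form_def)
  qed
qed

text \<open>A real supremum bounds its elements only if the set is bounded above, so the crude
  constant \<open>C\<close> is used first to establish boundedness. Then g is rescaled to norm 1 and
  Cauchy-Schwarz is applied to f and K g.\<close>

lemma kernel_form_le_opnorm:
  assumes K: "square_integrable_kernel a b p K" and fg: "f \<in> L2_vec a b p" "g \<in> L2_vec a b p"
  shows "\<bar>kernel_form a b p K f g\<bar> \<le> kernel_opnorm a b p K * (L2_norm a b p f * L2_norm a b p g)"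
proof -
  define C where "C = (\<Sum>i\<in>{1..p}. \<Sum>j\<in>{1..p}.
      sqrt (LINT z|(leb_Icc a b \<Otimes>\<^sub>M leb_Icc a b). (K i j (fst z) (snd z))\<^sup>2))"
  have C0: "0 \<le> C"
    unfolding C_def by (intro sum_nonneg) simp
  have C: "\<bar>kernel_form a b p K f g\<bar> \<le> C * (L2_norm a b p f * L2_norm a b p g)"
    if "f \<in> L2_vec a b p" "g \<in> L2_vec a b p" for f g
    unfolding C_def by (rule kernel_form_bound[OF K that])
  have bound: "L2_norm a b p (kernel_op a b p K h) \<le> C * L2_norm a b p h" if h: "h \<in> L2_vec a b p" for h
  proof -
    let ?N = "L2_norm a b p (kernel_op a b p K h)"
    \<comment> \<open>The squared norm of K h is the form at the pair K h, h; one factor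
      \<open>?N\<close> then cancels.\<close>
    have "?N * ?N \<le> (C * L2_norm a b p h) * ?N"
      using C[OF kernel_op_L2(1)[OF K h] h] kernel_op_L2(2)[OF K h kernel_op_L2(1)[OF K h]]
      by (simp add: mult_ac flip: L2_norm_power2 power2_eq_square)
    then show ?thesis
      using C0 L2_norm_nonneg[of a b p h] L2_norm_nonneg[of a b p "kernel_op a b p K h"]
      by (cases "?N = 0") (auto simp: mult_le_cancel_right)
  qed
  have bdd: "bdd_above ((\<lambda>f. L2_norm a b p (kernel_op a b p K f)) ` {f \<in> L2_vec a b p. L2_norm a b p f \<le> 1})"
  proof (intro bdd_aboveI2[where M = C])
    fix h assume "h \<in> {f \<in> L2_vec a b p. L2_norm a b p f \<le> 1}"
    then show "L2_norm a b p (kernel_op a b p K h) \<le> C"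
      using bound[of h] C0 mult_left_mono[of "L2_norm a b p h" 1 C] by auto
  qed
  show ?thesis
  proof (cases "L2_norm a b p g = 0")
    case True
    \<comment> \<open>A g of norm 0 cannot be rescaled, but there the crude bound already gives
      0.\<close>
    then show ?thesis using C[OF fg] by simp
  next
    case False
    then have pos: "0 < L2_norm a b p g"
      using L2_norm_nonneg[of a b p g] by simp
    define t where "t = 1 / L2_norm a b p g"
    define g' where "g' = (\<lambda>i u. t * g i u)"
    have norm_scale: "L2_norm a b p (\<lambda>i u. s * h i u) = \<bar>s\<bar> * L2_norm a b p h" for s h
    proof -
      have "L2_inner a b p (\<lambda>i u. s * h i u) (\<lambda>i u. s * h i u) = (LINT u|leb_Icc a b. s\<^sup>2 * (\<Sum>i\<in>{1..p}. h i u * h i u))"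
        unfolding L2_inner_def by (simp add: sum_distrib_left power2_eq_square mult_ac)
      also have "\<dots> = s\<^sup>2 * L2_inner a b p h h"
        unfolding L2_inner_def by simp
      finally show ?thesis
        by (simp add: L2_norm_def real_sqrt_mult)
    qed
    have "kernel_op a b p K g' i u = t * kernel_op a b p K g i u" for i u
    proof -
      have "kernel_op a b p K g' i u = (LINT v|leb_Icc a b. t * (\<Sum>j\<in>{1..p}. K i j u v * g j v))"
        unfolding kernel_op_def g'_def by (simp add: sum_distrib_left mult_ac)
      then show ?thesis by (simp add: kernel_op_def)
    qed
    then have op: "kernel_op a b p K g' = (\<lambda>i u. t * kernel_op a b p K g i u)"
      by blast
    have "g' \<in> L2_vec a b p"
      using fg(2) unfolding g'_def L2_vec_iff by (auto intro: square_integrable_scale)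
    moreover have "L2_norm a b p g' \<le> 1"
      using pos unfolding g'_def norm_scale by (simp add: t_def)
    ultimately have "L2_norm a b p (kernel_op a b p K g') \<le> kernel_opnorm a b p K"
      unfolding kernel_opnorm_def by (intro cSUP_upper bdd) simp
    then have "L2_norm a b p (kernel_op a b p K g) \<le> kernel_opnorm a b p K * L2_norm a b p g"
      using pos unfolding op norm_scale by (simp add: t_def field_simps)
    moreover have "\<bar>kernel_form a b p K f g\<bar> \<le> L2_norm a b p f * L2_norm a b p (kernel_op a b p K g)"
      using L2_Cauchy_Schwarz[OF fg(1) kernel_op_L2(1)[OF K fg(2)]] kernel_op_L2(2)[OF K fg(2,1)] by simp
    ultimately show ?thesis
      using mult_left_mono[of "L2_norm a b p (kernel_op a b p K g)"
          "kernel_opnorm a b p K * L2_norm a b p g" "L2_norm a b p f"] L2_norm_nonneg[of a b p f]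
      by (simp add: mult.left_commute)
  qed
qed

lemma kernel_opnorm_nonneg:
  assumes K: "square_integrable_kernel a b p K" and f: "f \<in> L2_vec a b p" "0 < L2_norm a b p f"
  shows "0 \<le> kernel_opnorm a b p K"
proof -
  have "0 \<le> kernel_opnorm a b p K * (L2_norm a b p f * L2_norm a b p f)"
    using kernel_form_le_opnorm[OF K f(1) f(1)] by linarith
  then show ?thesis
    using mult_pos_pos[OF f(2) f(2)] by (simp add: zero_le_mult_iff)
qed

subsection \<open>Eigensystems\<close>

text \<open>Gaussian elimination, by induction on the equations: an equation with only zero
  coefficients is dropped, any other one is solved for an unknown \<open>l\<close> with nonzero
  coefficient, which costs one equation and one unknown.\<close>

lemma underdetermined_system:
  fixes c :: "'k \<Rightarrow> 'i \<Rightarrow> real"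
  assumes "finite K" "finite I" "card K < card I"
  shows "\<exists>x. (\<exists>i\<in>I. x i \<noteq> 0) \<and> (\<forall>k\<in>K. (\<Sum>i\<in>I. x i * c k i) = 0)"
  using assms
proof (induction K arbitrary: I c rule: finite_induct)
  case empty
  then obtain i where "i \<in> I"
    by fastforce
  then show ?case
    by (intro exI[of _ "\<lambda>_. 1"]) auto
next
  case (insert k K)
  show ?case
  proof (cases "\<forall>i\<in>I. c k i = 0")
    case True
    moreover obtain x where "\<exists>i\<in>I. x i \<noteq> 0" "\<forall>k\<in>K. (\<Sum>i\<in>I. x i * c k i) = 0"
      using insert.IH[of I c] insert.prems insert.hyps by auto
    ultimately show ?thesis
      by (intro exI[of _ x]) auto
  next
    case False
    then obtain l where l: "l \<in> I" "c k l \<noteq> 0"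
      by blast
    define J where "J = I - {l}"
    \<comment> \<open>The coefficients of equation \<open>h\<close> after \<open>l\<close> has been
      eliminated by means of equation \<open>k\<close>.\<close>
    define d where "d h i = c h i - c h l * c k i / c k l" for h i
    have J: "finite J" "card K < card J" "l \<notin> J" "I = insert l J"
      using insert.prems insert.hyps l by (auto simp: J_def)
    obtain x where x: "\<exists>i\<in>J. x i \<noteq> 0" "\<forall>h\<in>K. (\<Sum>i\<in>J. x i * d h i) = 0"
      using insert.IH[of J d] J by auto
    \<comment> \<open>The value at \<open>l\<close> is the one that equation \<open>k\<close>
      forces.\<close>
    define z where "z = x(l := - (\<Sum>i\<in>J. x i * c k i) / c k l)"
    have zJ: "(\<Sum>i\<in>J. z i * f i) = (\<Sum>i\<in>J. x i * f i)" for f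
      using J(3) by (intro sum.cong) (auto simp: z_def)
    have "(\<Sum>i\<in>I. z i * c h i) = 0" if "h \<in> insert k K" for h
    proof -
      have "(\<Sum>i\<in>I. z i * c h i) = (\<Sum>i\<in>J. x i * c h i) - (\<Sum>i\<in>J. x i * c k i) * c h l / c k l"
        using J by (simp add: zJ) (simp add: z_def)
      also have "\<dots> = (\<Sum>i\<in>J. x i * d h i)"
        by (simp add: d_def right_diff_distrib sum_subtractf sum_distrib_left sum_distrib_right sum_divide_distrib mult_ac)
      \<comment> \<open>For \<open>h = k\<close> all reduced coefficients vanish; for the other
        equations this is the choice of \<open>x\<close>.\<close>
      also have "\<dots> = 0"
        using that x(2) l(2) by (auto simp: d_def)
      finally show ?thesis .
    qed
    moreover have "\<exists>i\<in>I. z i \<noteq> 0"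
      using x(1) J by (auto simp: z_def)
    ultimately show ?thesis by blast
  qed
qed

text \<open>The dimension count behind both Weyl inequalities. By orthonormality the sum of squares
  is the squared norm of the combination, so its positivity permits division at the end of those
  proofs.\<close>

lemma exists_lincomb_orthogonal:
  assumes I: "finite I" "L2_orthonormal a b p I e" and K: "finite K" "card K < card I"
    and g: "\<And>k. k \<in> K \<Longrightarrow> g k \<in> L2_vec a b p"
  obtains x where "0 < (\<Sum>i\<in>I. (x i)\<^sup>2)"
    and "\<And>k. k \<in> K \<Longrightarrow> L2_inner a b p (g k) (\<lambda>i u. \<Sum>l\<in>I. x l * e l i u) = 0"
proof -
  obtain x where x: "\<exists>i\<in>I. x i \<noteq> 0" "\<forall>k\<in>K. (\<Sum>i\<in>I. x i * L2_inner a b p (g k) (e i)) = 0"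
    using underdetermined_system[OF K(1) I(1) K(2), of "\<lambda>k i. L2_inner a b p (g k) (e i)"] by auto
  show thesis
  proof (rule that)
    show "0 < (\<Sum>i\<in>I. (x i)\<^sup>2)"
      using x(1) I(1) by (auto intro!: sum_pos2)
    show "L2_inner a b p (g k) (\<lambda>i u. \<Sum>l\<in>I. x l * e l i u) = 0" if "k \<in> K" for k
      using x(2) I(2) g that by (subst L2_inner_lincomb_right) (auto simp: L2_orthonormal_def)
  qed
qed

section \<open>Spectral facts for a Mercer system\<close>

lemma mercer_systemD:
  assumes "mercer_system a b p K \<tau> \<phi>"
  shows "\<And>k. 1 \<le> k \<Longrightarrow> 0 \<le> \<tau> k" and "\<And>k l. 1 \<le> k \<Longrightarrow> k \<le> l \<Longrightarrow> \<tau> l \<le> \<tau> k"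
    and "L2_orthonormal a b p {1..} \<phi>"
proof -
  have step: "0 \<le> \<tau> (Suc k)" "\<tau> (Suc k) \<le> \<tau> k" if "1 \<le> k" for k
    using assms that by (auto simp: mercer_system_def)
  \<comment> \<open>The definition states nonnegativity from index 2 on; \<tau> 1 inherits it from
    the ordering.\<close>
  show "0 \<le> \<tau> k" if "1 \<le> k" for k
    using step[OF that] by linarith
  show "\<tau> l \<le> \<tau> k" if "1 \<le> k" "k \<le> l" for k l
    using that(2)
  proof (induction l rule: dec_induct)
    case (step n)
    then show ?case
      using \<open>\<And>k. 1 \<le> k \<Longrightarrow> \<tau> (Suc k) \<le> \<tau> k\<close>[of n] that(1) by simp
  qed simp
  show "L2_orthonormal a b p {1..} \<phi>"
    using assms by (auto simp: mercer_system_def L2_orthonormal_def)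
qed

text \<open>The eigenvalue equation holds almost everywhere in each component, which is enough after
  integration against f.\<close>

lemma mercer_eigenfunction:
  assumes m: "mercer_system a b p K \<tau> \<phi>" and K: "square_integrable_kernel a b p K"
    and k: "1 \<le> k" and f: "f \<in> L2_vec a b p"
  shows "kernel_form a b p K f (\<phi> k) = \<tau> k * L2_inner a b p f (\<phi> k)"
proof -
  have \<phi>: "\<phi> k \<in> L2_vec a b p"
    using m k by (auto simp: mercer_system_def)
  have "kernel_form a b p K f (\<phi> k) = L2_inner a b p f (kernel_op a b p K (\<phi> k))"
    by (rule kernel_op_L2(2)[OF K \<phi> f, symmetric])
  also have "\<dots> = (\<Sum>i\<in>{1..p}. LINT u|leb_Icc a b. f i u * kernel_op a b p K (\<phi> k) i u)"
    by (rule L2_inner_eq_sum[OF f kernel_op_L2(1)[OF K \<phi>]])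
  also have "\<dots> = (\<Sum>i\<in>{1..p}. LINT u|leb_Icc a b. \<tau> k * (f i u * \<phi> k i u))"
  proof (intro sum.cong refl integral_cong_AE)
    fix i assume i: "i \<in> {1..p}"
    have [measurable]: "f i \<in> borel_measurable (leb_Icc a b)" "\<phi> k i \<in> borel_measurable (leb_Icc a b)"
      "kernel_op a b p K (\<phi> k) i \<in> borel_measurable (leb_Icc a b)"
      using f \<phi> kernel_op_L2(1)[OF K \<phi>] i by (auto simp: L2_vec_iff square_integrable_def)
    show "(\<lambda>u. f i u * kernel_op a b p K (\<phi> k) i u) \<in> borel_measurable (leb_Icc a b)"
      "(\<lambda>u. \<tau> k * (f i u * \<phi> k i u)) \<in> borel_measurable (leb_Icc a b)"
      by measurable
    have "AE u in leb_Icc a b. kernel_op a b p K (\<phi> k) i u = \<tau> k * \<phi> k i u"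
      using m k i by (auto simp: mercer_system_def)
    then show "AE u in leb_Icc a b. f i u * kernel_op a b p K (\<phi> k) i u = \<tau> k * (f i u * \<phi> k i u)"
      by eventually_elim simp
  qed
  also have "\<dots> = \<tau> k * L2_inner a b p f (\<phi> k)"
    by (simp add: L2_inner_eq_sum[OF f \<phi>] sum_distrib_left)
  finally show ?thesis .
qed

text \<open>The partial sums are the forms of the truncated kernels \<open>T n\<close>. The
  remainder \<open>D n\<close> tends to 0 in L2 by the Mercer expansion, and
  \<open>kernel_form_bound\<close> transfers this to its form.\<close>

lemma mercer_expansion:
  assumes m: "mercer_system a b p K \<tau> \<phi>" and K: "square_integrable_kernel a b p K"
    and f: "f \<in> L2_vec a b p"
  shows "(\<lambda>n. \<Sum>k=1..n. \<tau> k * (L2_inner a b p (\<phi> k) f)\<^sup>2) \<longlonglongrightarrow> kernel_form a b p K f f"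
proof -
  let ?P = "leb_Icc a b \<Otimes>\<^sub>M leb_Icc a b"
  define T where "T n = (\<lambda>i j u v. \<Sum>k\<in>{1..n}. \<tau> k * \<phi> k i u * \<phi> k j v)" for n
  define D where "D n = (\<lambda>i j u v. K i j u v - T n i j u v)" for n
  have \<phi>: "\<phi> k \<in> L2_vec a b p" if "k \<in> {1..n}" for k n
    using m that by (auto simp: mercer_system_def)
  have T: "square_integrable_kernel a b p (T n)" for n
    unfolding T_def using \<phi> by (rule square_integrable_kernel_finite_rank)
  have D: "square_integrable_kernel a b p (D n)" for n
    unfolding D_def using K T by (rule square_integrable_kernel_diff)
  have Tform: "kernel_form a b p (T n) f f = (\<Sum>k=1..n. \<tau> k * (L2_inner a b p (\<phi> k) f)\<^sup>2)" for n
    unfolding T_def using kernel_form_finite_rank[of "{1..n}" \<phi> a b p f f \<tau>, OF \<phi>[of _ n] f f] by (simp add: power2_eq_square mult.assoc)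
  have split: "kernel_form a b p K f f = kernel_form a b p (D n) f f + kernel_form a b p (T n) f f" for n
    using kernel_form_add[OF D[of n] T[of n] f f] by (simp add: D_def)
  define C where "C n = (\<Sum>i\<in>{1..p}. \<Sum>j\<in>{1..p}. sqrt (LINT z|?P. (D n i j (fst z) (snd z))\<^sup>2)) *
    (L2_norm a b p f * L2_norm a b p f)" for n
  have "(\<lambda>n. LINT z|?P. (D n i j (fst z) (snd z))\<^sup>2) \<longlonglongrightarrow> 0" if "i \<in> {1..p}" "j \<in> {1..p}" for i j
    using m that unfolding D_def T_def mercer_system_def case_prod_beta by blast
  then have sqrt_lim: "(\<lambda>n. sqrt (LINT z|?P. (D n i j (fst z) (snd z))\<^sup>2)) \<longlonglongrightarrow> sqrt 0"
    if "i \<in> {1..p}" "j \<in> {1..p}" for i j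
    using that by (intro tendsto_real_sqrt)
  have "C \<longlonglongrightarrow> (\<Sum>i\<in>{1..p}. \<Sum>j\<in>{1..p}. sqrt 0) * (L2_norm a b p f * L2_norm a b p f)"
    unfolding C_def by (intro tendsto_mult tendsto_sum tendsto_const sqrt_lim)
  then have C: "C \<longlonglongrightarrow> 0"
    by simp
  have "(\<lambda>n. kernel_form a b p (D n) f f) \<longlonglongrightarrow> 0"
    using kernel_form_bound[OF D f f]
    by (intro Lim_null_comparison[OF _ C] always_eventually allI) (simp only: C_def real_norm_def)
  then have "(\<lambda>n. kernel_form a b p K f f - kernel_form a b p (D n) f f) \<longlonglongrightarrow> kernel_form a b p K f f - 0"
    by (intro tendsto_intros)
  moreover have "kernel_form a b p K f f - kernel_form a b p (D n) f f =
      (\<Sum>k=1..n. \<tau> k * (L2_inner a b p (\<phi> k) f)\<^sup>2)" for n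
    using split[of n] Tform[of n] by simp
  ultimately show ?thesis by simp
qed

text \<open>The upper half of the Rayleigh principle. In every partial sum of the expansion the
  terms before j vanish and the others carry eigenvalues at most \<tau> j; since \<tau> j is
  nonnegative, Bessel's inequality bounds all partial sums at once, hence their limit.\<close>

lemma mercer_form_le:
  assumes m: "mercer_system a b p K \<tau> \<phi>" and K: "square_integrable_kernel a b p K"
    and f: "f \<in> L2_vec a b p" and j: "1 \<le> j"
    and orth: "\<And>k. k \<in> {1..<j} \<Longrightarrow> L2_inner a b p (\<phi> k) f = 0"
  shows "kernel_form a b p K f f \<le> \<tau> j * L2_inner a b p f f"
proof (rule LIMSEQ_le_const2[OF mercer_expansion[OF m K f]], intro exI allI impI)
  fix n :: nat
  have "(\<Sum>k=1..n. \<tau> k * (L2_inner a b p (\<phi> k) f)\<^sup>2) \<le> (\<Sum>k=1..n. \<tau> j * (L2_inner a b p (\<phi> k) f)\<^sup>2)"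
  proof (rule sum_mono)
    fix k assume k: "k \<in> {1..n}"
    show "\<tau> k * (L2_inner a b p (\<phi> k) f)\<^sup>2 \<le> \<tau> j * (L2_inner a b p (\<phi> k) f)\<^sup>2"
    proof (cases "k < j")
      case True
      then show ?thesis using orth[of k] k by simp
    next
      case False
      then show ?thesis
        using mercer_systemD(2)[OF m j, of k] by (intro mult_right_mono) auto
    qed
  qed
  also have "\<dots> = \<tau> j * (\<Sum>k=1..n. (L2_inner a b p (\<phi> k) f)\<^sup>2)"
    by (simp add: sum_distrib_left)
  also have "\<dots> \<le> \<tau> j * L2_inner a b p f f"
    using mercer_systemD(1)[OF m j] L2_orthonormal_subset[OF mercer_systemD(3)[OF m]] f
    by (intro mult_left_mono L2_Bessel) auto
  finally show "(\<Sum>k=1..n. \<tau> k * (L2_inner a b p (\<phi> k) f)\<^sup>2) \<le> \<tau> j * L2_inner a b p f f" .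
qed

subsection \<open>Perturbation of a finite-rank kernel\<close>

lemma L2_inner_scale_left: "L2_inner a b p (\<lambda>i u. s * f i u) g = s * L2_inner a b p f g"
proof -
  have "L2_inner a b p (\<lambda>i u. s * f i u) g = (LINT u|leb_Icc a b. s * (\<Sum>i\<in>{1..p}. f i u * g i u))"
    unfolding L2_inner_def by (simp add: sum_distrib_left mult.assoc)
  then show ?thesis
    by (simp add: L2_inner_def)
qed

text \<open>The deterministic situation for one fixed dimension p: \<open>K\<close> is \<Sigma>y,
  \<open>E\<close> is \<Sigma>\<epsilon>, the q_k are the columns of Q, and \<mu> k = p \<theta> k.
  The \<mu> k are ordered only weakly here; the separation needed for eigenfunctions is a hypothesis
  of \<open>eigenfunction_close\<close>, which makes its constants explicit.\<close>

locale perturbed_factor_kernel =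
  fixes a b :: real and p r :: nat
    and K E :: "nat \<Rightarrow> nat \<Rightarrow> real \<Rightarrow> real \<Rightarrow> real"
    and q \<phi> :: "nat \<Rightarrow> nat \<Rightarrow> real \<Rightarrow> real" and \<mu> \<tau> :: "nat \<Rightarrow> real"
  assumes r: "1 \<le> r"
    and E: "square_integrable_kernel a b p E"
    and E_sym: "\<And>i j u v. i \<in> {1..p} \<Longrightarrow> j \<in> {1..p} \<Longrightarrow> u \<in> {a..b} \<Longrightarrow> v \<in> {a..b} \<Longrightarrow>
      E i j u v = E j i v u"
    and q: "\<And>k. k \<in> {1..r} \<Longrightarrow> q k \<in> L2_vec a b p"
    and K_eq: "\<And>i j u v. i \<in> {1..p} \<Longrightarrow> j \<in> {1..p} \<Longrightarrow> u \<in> {a..b} \<Longrightarrow> v \<in> {a..b} \<Longrightarrow>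
      K i j u v = (\<Sum>k\<in>{1..r}. q k i u * q k j v) + E i j u v"
    and mercer: "mercer_system a b p K \<tau> \<phi>"
    and q_inner: "\<And>j k. j \<in> {1..r} \<Longrightarrow> k \<in> {1..r} \<Longrightarrow>
      L2_inner a b p (q j) (q k) = (if j = k then \<mu> j else 0)"
    and \<mu>_pos: "\<And>k. k \<in> {1..r} \<Longrightarrow> 0 < \<mu> k"
    and \<mu>_antimono: "\<And>j k. j \<in> {1..r} \<Longrightarrow> k \<in> {1..r} \<Longrightarrow> j \<le> k \<Longrightarrow> \<mu> k \<le> \<mu> j"
begin

abbreviation ip where "ip \<equiv> L2_inner a b p"

definition e :: real where "e = kernel_opnorm a b p E"

text \<open>The normalized columns: by \<open>q_inner\<close>, \<open>sqrt (\<mu> k)\<close> is the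
  norm of \<open>q k\<close>.\<close>

definition n :: "nat \<Rightarrow> nat \<Rightarrow> real \<Rightarrow> real" where
  "n k = (\<lambda>i u. 1 / sqrt (\<mu> k) * q k i u)"

text \<open>The factor 1 gives the sum the shape \<open>c k * q k i u * q k j v\<close> of the
  finite-rank lemmas.\<close>

lemma K_eq': "i \<in> {1..p} \<Longrightarrow> j \<in> {1..p} \<Longrightarrow> u \<in> {a..b} \<Longrightarrow> v \<in> {a..b} \<Longrightarrow>
    K i j u v = (\<Sum>k\<in>{1..r}. 1 * q k i u * q k j v) + E i j u v"
  by (simp add: K_eq)

lemma K: "square_integrable_kernel a b p K"
proof -
  have "square_integrable_kernel a b p (\<lambda>i j u v. (\<Sum>k\<in>{1..r}. 1 * q k i u * q k j v) + E i j u v)"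
    by (intro square_integrable_kernel_add square_integrable_kernel_finite_rank q E)
  moreover have "square_integrable (leb_Icc a b \<Otimes>\<^sub>M leb_Icc a b) (\<lambda>z. K i j (fst z) (snd z)) \<longleftrightarrow>
      square_integrable (leb_Icc a b \<Otimes>\<^sub>M leb_Icc a b)
        (\<lambda>z. (\<Sum>k\<in>{1..r}. 1 * q k i (fst z) * q k j (snd z)) + E i j (fst z) (snd z))"
    if "i \<in> {1..p}" "j \<in> {1..p}" for i j
    using that by (intro square_integrable_cong K_eq') (auto simp: space_pair_measure)
  ultimately show ?thesis
    unfolding square_integrable_kernel_def by blast
qed

lemma form_K:
  assumes "f \<in> L2_vec a b p" "g \<in> L2_vec a b p"
  shows "kernel_form a b p K f g = (\<Sum>k\<in>{1..r}. ip (q k) f * ip (q k) g) + kernel_form a b p E f g"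
proof -
  have "kernel_form a b p K f g =
      kernel_form a b p (\<lambda>i j u v. (\<Sum>k\<in>{1..r}. 1 * q k i u * q k j v) + E i j u v) f g"
    by (rule kernel_form_cong) (rule K_eq')
  also have "\<dots> = kernel_form a b p (\<lambda>i j u v. \<Sum>k\<in>{1..r}. 1 * q k i u * q k j v) f g + kernel_form a b p E f g"
    by (intro kernel_form_add square_integrable_kernel_finite_rank q E assms)
  also have "kernel_form a b p (\<lambda>i j u v. \<Sum>k\<in>{1..r}. 1 * q k i u * q k j v) f g =
      (\<Sum>k\<in>{1..r}. 1 * ip (q k) f * ip (q k) g)"
    by (intro kernel_form_finite_rank q assms)
  finally show ?thesis by simp
qed

lemma K_commute:
  assumes "f \<in> L2_vec a b p" "g \<in> L2_vec a b p"
  shows "kernel_form a b p K f g = kernel_form a b p K g f"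
  by (rule kernel_form_commute[OF K _ assms]) (simp add: K_eq E_sym mult.commute)

lemma n_L2: "k \<in> {1..r} \<Longrightarrow> n k \<in> L2_vec a b p"
  using q unfolding n_def L2_vec_iff by (blast intro: square_integrable_scale)

lemma ip_q: "k \<in> {1..r} \<Longrightarrow> ip (q k) f = sqrt (\<mu> k) * ip (n k) f"
  using \<mu>_pos[of k] unfolding n_def L2_inner_scale_left by simp

lemma n_orthonormal: "L2_orthonormal a b p {1..r} n"
proof -
  have "ip (n j) (n k) = (if j = k then 1 else 0)" if "j \<in> {1..r}" "k \<in> {1..r}" for j k
  proof -
    have "ip (n j) (n k) = 1 / sqrt (\<mu> j) * (1 / sqrt (\<mu> k) * ip (q k) (q j))"
      unfolding n_def by (simp only: L2_inner_scale_left L2_inner_commute[of a b p "q j"])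
    then show ?thesis
      using that \<mu>_pos[OF that(2)] by (cases "j = k") (simp_all add: q_inner)
  qed
  then show ?thesis
    unfolding L2_orthonormal_def using n_L2 by blast
qed

lemma \<phi>_orthonormal: "L2_orthonormal a b p {1..j} \<phi>"
  by (rule L2_orthonormal_subset[OF mercer_systemD(3)[OF mercer]]) auto

lemma \<phi>_L2: "1 \<le> k \<Longrightarrow> \<phi> k \<in> L2_vec a b p"
  using mercer by (auto simp: mercer_system_def)

lemma form_E: "f \<in> L2_vec a b p \<Longrightarrow> \<bar>kernel_form a b p E f f\<bar> \<le> e * ip f f"
  using kernel_form_le_opnorm[OF E, of f f] by (simp add: e_def L2_norm_power2 flip: power2_eq_square)

text \<open>Since \<open>1 \<le> r\<close>, the function \<open>n 1\<close> is available as a unit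
  vector.\<close>

lemma e_nonneg: "0 \<le> e"
proof -
  have "L2_norm a b p (n 1) = 1"
    using n_orthonormal r by (simp add: L2_norm_def L2_orthonormal_def)
  then show ?thesis
    unfolding e_def using r by (intro kernel_opnorm_nonneg[OF E n_L2, of 1]) auto
qed

text \<open>Weyl's upper inequality. Take a nonzero f in the span of \<phi> 1, ..., \<phi> j, where
  the form of \<open>K\<close> is at least \<tau> j times the squared norm, orthogonal to the
  normalized columns before the j-th, where the factor part is at most \<mu> j times it. For j > r,
  f is orthogonal to every column, the factor part vanishes, and only \<open>e\<close>
  remains.\<close>

lemma eigenvalue_upper:
  assumes j: "1 \<le> j"
  shows "\<tau> j \<le> (if j \<le> r then \<mu> j else 0) + e"
proof -
  let ?m = "if j \<le> r then \<mu> j else 0"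
  obtain x where pos: "0 < (\<Sum>i\<in>{1..j}. (x i)\<^sup>2)"
    and orth: "\<And>k. k \<in> {1..<j} \<inter> {1..r} \<Longrightarrow> ip (n k) (\<lambda>i u. \<Sum>l\<in>{1..j}. x l * \<phi> l i u) = 0"
  proof (rule exists_lincomb_orthogonal[OF _ \<phi>_orthonormal, of j "{1..<j} \<inter> {1..r}" n])
    \<comment> \<open>The intersection covers both j \<le> r and j > r; it imposes at most j - 1
      conditions on j coefficients.\<close>
    show "card ({1..<j} \<inter> {1..r}) < card {1..j}"
      using j by (intro psubset_card_mono) auto
  qed (auto intro: n_L2)
  define f where "f = (\<lambda>i u. \<Sum>l\<in>{1..j}. x l * \<phi> l i u)"
  have f: "f \<in> L2_vec a b p"
    unfolding f_def by (intro L2_vec_lincomb \<phi>_L2) auto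
  have ff: "ip f f = (\<Sum>i\<in>{1..j}. (x i)\<^sup>2)"
    unfolding f_def by (rule L2_inner_lincomb_orthonormal_self[OF _ \<phi>_orthonormal]) simp
  have ipf: "ip f (\<phi> l) = x l" if "l \<in> {1..j}" for l
    unfolding f_def using that by (subst L2_inner_commute) (rule L2_inner_lincomb_orthonormal[OF _ \<phi>_orthonormal], auto)
  have "\<tau> j * ip f f = (\<Sum>l\<in>{1..j}. \<tau> j * (x l)\<^sup>2)"
    by (simp add: ff sum_distrib_left)
  also have "\<dots> \<le> (\<Sum>l\<in>{1..j}. \<tau> l * (x l)\<^sup>2)"
    using mercer_systemD(2)[OF mercer] by (intro sum_mono mult_right_mono) auto
  also have "\<dots> = (\<Sum>l\<in>{1..j}. x l * kernel_form a b p K f (\<phi> l))"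
    using f by (intro sum.cong) (auto simp: mercer_eigenfunction[OF mercer K] ipf power2_eq_square)
  also have "\<dots> = kernel_form a b p K f f"
    using kernel_form_lincomb_right[OF K f, of "{1..j}" \<phi> x, folded f_def] \<phi>_L2 by simp
  also have "\<dots> = (\<Sum>k\<in>{1..r}. ip (q k) f * ip (q k) f) + kernel_form a b p E f f"
    by (rule form_K[OF f f])
  also have "(\<Sum>k\<in>{1..r}. ip (q k) f * ip (q k) f) \<le> (\<Sum>k\<in>{1..r}. ?m * (ip (n k) f)\<^sup>2)"
  proof (rule sum_mono)
    fix k assume k: "k \<in> {1..r}"
    have "ip (q k) f * ip (q k) f = \<mu> k * (ip (n k) f)\<^sup>2"
      using \<mu>_pos[OF k] by (simp add: ip_q[OF k] power2_eq_square)
    also have "\<dots> \<le> ?m * (ip (n k) f)\<^sup>2"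
    proof (cases "k < j")
      case True
      then show ?thesis using orth[of k] k by (simp add: f_def)
    next
      case False
      \<comment> \<open>Here j \<le> k \<le> r, so \<open>?m\<close> is \<mu> j.\<close>
      then show ?thesis using k j \<mu>_antimono[of j k] by (intro mult_right_mono) auto
    qed
    finally show "ip (q k) f * ip (q k) f \<le> ?m * (ip (n k) f)\<^sup>2" .
  qed
  also have "(\<Sum>k\<in>{1..r}. ?m * (ip (n k) f)\<^sup>2) = ?m * (\<Sum>k\<in>{1..r}. (ip (n k) f)\<^sup>2)"
    by (simp add: sum_distrib_left)
  also have "\<dots> \<le> ?m * ip f f"
    using \<mu>_pos[of j] j by (intro mult_left_mono L2_Bessel n_orthonormal f) auto
  also have "kernel_form a b p E f f \<le> e * ip f f"
    using form_E[OF f] by simp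
  finally have "\<tau> j * ip f f \<le> (?m + e) * ip f f"
    by (simp add: distrib_right)
  then show ?thesis
    using pos by (simp add: ff)
qed

text \<open>Weyl's lower inequality, with the families exchanged: f lies in the span of
  \<open>n 1\<close>, ..., \<open>n j\<close>, where the factor part is at least \<mu> j times the
  squared norm, and is orthogonal to the eigenfunctions before the j-th, where the form of
  \<open>K\<close> is at most \<tau> j times it.\<close>

lemma eigenvalue_lower:
  assumes j: "j \<in> {1..r}"
  shows "\<mu> j - e \<le> \<tau> j"
proof -
  have sub: "L2_orthonormal a b p {1..j} n"
    using j by (intro L2_orthonormal_subset[OF n_orthonormal]) auto
  obtain x where pos: "0 < (\<Sum>i\<in>{1..j}. (x i)\<^sup>2)"
    and orth: "\<And>k. k \<in> {1..<j} \<Longrightarrow> ip (\<phi> k) (\<lambda>i u. \<Sum>l\<in>{1..j}. x l * n l i u) = 0"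
  proof (rule exists_lincomb_orthogonal[OF _ sub, of "{1..<j}" \<phi>])
    show "card {1..<j} < card {1..j}"
      using j by simp
  qed (auto intro: \<phi>_L2)
  define f where "f = (\<lambda>i u. \<Sum>l\<in>{1..j}. x l * n l i u)"
  have f: "f \<in> L2_vec a b p"
    unfolding f_def using j by (intro L2_vec_lincomb n_L2) auto
  have ff: "ip f f = (\<Sum>i\<in>{1..j}. (x i)\<^sup>2)"
    unfolding f_def by (rule L2_inner_lincomb_orthonormal_self[OF _ sub]) simp
  have ipf: "ip (n l) f = x l" if "l \<in> {1..j}" for l
    unfolding f_def using that by (intro L2_inner_lincomb_orthonormal[OF _ sub]) auto
  have "\<mu> j * ip f f = (\<Sum>l\<in>{1..j}. \<mu> j * (x l)\<^sup>2)"
    by (simp add: ff sum_distrib_left)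
  also have "\<dots> \<le> (\<Sum>l\<in>{1..j}. \<mu> l * (x l)\<^sup>2)"
    using j by (intro sum_mono mult_right_mono \<mu>_antimono) auto
  also have "\<dots> = (\<Sum>l\<in>{1..j}. ip (q l) f * ip (q l) f)"
    using j \<mu>_pos by (intro sum.cong) (auto simp: ip_q ipf power2_eq_square less_imp_le)
  \<comment> \<open>The terms added are squares.\<close>
  also have "\<dots> \<le> (\<Sum>l\<in>{1..r}. ip (q l) f * ip (q l) f)"
    using j by (intro sum_mono2) auto
  also have "\<dots> = kernel_form a b p K f f - kernel_form a b p E f f"
    by (simp add: form_K[OF f f])
  also have "\<dots> \<le> \<tau> j * ip f f + e * ip f f"
  proof -
    have "kernel_form a b p K f f \<le> \<tau> j * ip f f"
      using orth j by (intro mercer_form_le[OF mercer K f]) (auto simp: f_def)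
    then show ?thesis
      using form_E[OF f] by linarith
  qed
  finally have "(\<mu> j - e) * ip f f \<le> \<tau> j * ip f f"
    by (simp add: left_diff_distrib)
  then show ?thesis
    using pos by (simp add: ff)
qed

text \<open>A perturbation bound of Davis-Kahan type. \<open>g\<close> is half a lower bound for the
  distance from \<mu> j to the other \<mu> k and to 0, the rest of the spectrum of the factor part.
  The perturbation moves eigenvalues by at most \<open>e \<le> g\<close>, so a gap \<open>g\<close>
  survives. The sign s is chosen to make the inner product of s \<phi> j with \<open>n j\<close>
  nonnegative.\<close>

lemma eigenfunction_close:
  assumes j: "j \<in> {1..r}" and g: "0 < g" "e \<le> g" "2 * g \<le> \<mu> j"
    and gap: "\<And>k. k \<in> {1..r} \<Longrightarrow> k \<noteq> j \<Longrightarrow> 2 * g \<le> \<bar>\<mu> k - \<mu> j\<bar>"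
  shows "\<exists>s\<in>{-1, 1}. L2_norm a b p (\<lambda>i u. s * \<phi> j i u - n j i u) \<le> sqrt (2 * r) * (e / g)"
proof -
  define c where "c k = ip (\<phi> k) (n j)" for k
  define w where "w = (\<lambda>i u. 1 * n j i u + (-1) * (\<Sum>k\<in>{1..r}. c k * \<phi> k i u))"
  \<comment> \<open>In order: \<open>w\<close> is in L2, it is orthogonal to \<phi> 1, ..., \<phi>
    r, Pythagoras, and its inner product with \<open>n j\<close> is its squared norm.\<close>
  note w = L2_residual[OF _ \<phi>_orthonormal n_L2[OF j], of r, folded c_def, folded w_def, simplified]
  have nj: "n j \<in> L2_vec a b p" "ip (n j) (n j) = 1" "L2_norm a b p (n j) = 1"
    using n_orthonormal j by (auto simp: L2_orthonormal_def L2_norm_def)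
  \<comment> \<open>By orthogonality of the columns, \<open>n j\<close> is an eigenfunction of the
    factor part with eigenvalue \<mu> j.\<close>
  have form_n: "kernel_form a b p K f (n j) = \<mu> j * ip (n j) f + kernel_form a b p E f (n j)"
    if f: "f \<in> L2_vec a b p" for f
  proof -
    have "(\<Sum>k\<in>{1..r}. ip (q k) f * ip (q k) (n j)) = (\<Sum>k\<in>{1..r}. if k = j then \<mu> k * ip (n k) f else 0)"
    proof (rule sum.cong[OF refl])
      fix k assume k: "k \<in> {1..r}"
      have "ip (n k) (n j) = (if k = j then 1 else 0)"
        using n_orthonormal j k by (simp add: L2_orthonormal_def)
      then show "ip (q k) f * ip (q k) (n j) = (if k = j then \<mu> k * ip (n k) f else 0)"
        unfolding ip_q[OF k] using \<mu>_pos[OF k] by (cases "k = j") simp_all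
    qed
    then show ?thesis
      using j by (simp add: form_K[OF f nj(1)])
  qed
  have E_n: "\<bar>kernel_form a b p E f (n j)\<bar> \<le> e * L2_norm a b p f" if "f \<in> L2_vec a b p" for f
    using kernel_form_le_opnorm[OF E that nj(1)] nj(3) by (simp add: e_def)
  have c_bound: "(c k)\<^sup>2 \<le> (e / g)\<^sup>2" if k: "k \<in> {1..r}" "k \<noteq> j" for k
  proof -
    have \<phi>k: "\<phi> k \<in> L2_vec a b p" "ip (\<phi> k) (\<phi> k) = 1"
      using \<phi>_orthonormal[of r] k by (auto simp: L2_orthonormal_def)
    have "kernel_form a b p K (\<phi> k) (n j) = \<tau> k * c k"
      using k mercer_eigenfunction[OF mercer K _ nj(1), of k]
      by (simp add: K_commute[OF \<phi>k(1) nj(1)] c_def L2_inner_commute)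
    \<comment> \<open>Two evaluations of the same form are compared: through the eigenfunction
      \<phi> k of \<open>K\<close>, and through \<open>n j\<close>.\<close>
    then have "(\<tau> k - \<mu> j) * c k = kernel_form a b p E (\<phi> k) (n j)"
      using form_n[OF \<phi>k(1)] by (simp add: c_def L2_inner_commute[of a b p "n j"] left_diff_distrib)
    then have "\<bar>\<tau> k - \<mu> j\<bar> * \<bar>c k\<bar> \<le> e"
      using E_n[OF \<phi>k(1)] \<phi>k(2) by (simp add: L2_norm_def flip: abs_mult)
    moreover have "g \<le> \<bar>\<tau> k - \<mu> j\<bar>"
      \<comment> \<open>\<mu> k is at least 2 g away from \<mu> j, and \<tau> k is within
        \<open>e \<le> g\<close> of \<mu> k.\<close>
      using gap[OF k] eigenvalue_upper[of k] eigenvalue_lower[OF k(1)] k(1) g(2) by (simp split: if_splits)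
    then have "g * \<bar>c k\<bar> \<le> \<bar>\<tau> k - \<mu> j\<bar> * \<bar>c k\<bar>"
      by (intro mult_right_mono) auto
    ultimately have "\<bar>c k\<bar> \<le> e / g"
      using g(1) by (simp add: field_simps)
    then have "\<bar>c k\<bar>\<^sup>2 \<le> (e / g)\<^sup>2"
      by (intro power_mono) auto
    then show ?thesis by simp
  qed
  have w_bound: "ip w w \<le> (e / g)\<^sup>2"
  proof -
    \<comment> \<open>\<open>K\<close> maps \<phi> k to a multiple of itself, which is orthogonal to
      \<open>w\<close>. Hence the projected part of \<open>n j\<close> drops out, and the form at w,
      \<open>n j\<close> equals the form at w, w.\<close>
    have "kernel_form a b p K w (\<phi> k) = 0" if "k \<in> {1..r}" for k
      using that w(2)[of k] by (simp add: mercer_eigenfunction[OF mercer K _ w(1)] L2_inner_commute)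
    then have "kernel_form a b p K w (\<lambda>i u. \<Sum>k\<in>{1..r}. c k * \<phi> k i u) = 0"
      using \<phi>_L2 by (subst kernel_form_lincomb_right[OF K w(1)]) auto
    moreover have "(\<lambda>i u. \<Sum>k\<in>{1..r}. c k * \<phi> k i u) \<in> L2_vec a b p"
      using \<phi>_L2 by (intro L2_vec_lincomb) auto
    ultimately have "kernel_form a b p K w w = kernel_form a b p K w (n j)"
      using kernel_form_comb2_right[OF K w(1) nj(1), of "\<lambda>i u. \<Sum>k\<in>{1..r}. c k * \<phi> k i u" 1 "-1"]
      by (simp add: w_def)
    also have "\<dots> = \<mu> j * ip w w + kernel_form a b p E w (n j)"
      using form_n[OF w(1)] w(4) by (simp add: L2_inner_commute)
    finally have "(\<mu> j - e) * ip w w \<le> e * L2_norm a b p w"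
    proof -
      assume eq: "kernel_form a b p K w w = \<mu> j * ip w w + kernel_form a b p E w (n j)"
      \<comment> \<open>\<open>w\<close> is orthogonal to the first r eigenfunctions, so
        \<open>Suc r\<close> is the first index that counts, and there
        \<open>eigenvalue_upper\<close> leaves only \<open>e\<close>.\<close>
      have "kernel_form a b p K w w \<le> \<tau> (Suc r) * ip w w"
        using w(2) by (intro mercer_form_le[OF mercer K w(1)]) auto
      also have "\<dots> \<le> e * ip w w"
        using eigenvalue_upper[of "Suc r"] by (intro mult_right_mono L2_inner_nonneg) auto
      finally show ?thesis
        using eq E_n[OF w(1)] by (simp add: left_diff_distrib)
    qed
    moreover have "g * ip w w \<le> (\<mu> j - e) * ip w w"
      using g by (intro mult_right_mono L2_inner_nonneg) auto
    ultimately have "(g * L2_norm a b p w) * L2_norm a b p w \<le> e * L2_norm a b p w"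
      by (simp add: mult.assoc L2_norm_power2 flip: power2_eq_square)
    then have "L2_norm a b p w \<le> e / g"
      using L2_norm_nonneg[of a b p w] e_nonneg g(1)
      by (cases "L2_norm a b p w = 0") (auto simp: field_simps)
    then show ?thesis
      unfolding L2_norm_power2[symmetric] by (intro power_mono L2_norm_nonneg)
  qed
  \<comment> \<open>Pythagoras for the unit vector \<open>n j\<close>. The r - 1 coefficients other
    than \<open>c j\<close>, together with \<open>w\<close>, give r terms, each at most
    \<open>(e / g)\<^sup>2\<close>.\<close>
  have "1 - (c j)\<^sup>2 = (\<Sum>k\<in>{1..r} - {j}. (c k)\<^sup>2) + ip w w"
    using w(3) nj(2) j sum.remove[of "{1..r}" j "\<lambda>k. (c k)\<^sup>2"] by simp
  also have "\<dots> \<le> of_nat (card ({1..r} - {j})) * (e / g)\<^sup>2 + (e / g)\<^sup>2"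
    by (intro add_mono sum_bounded_above w_bound) (auto intro: c_bound)
  also have "\<dots> = r * (e / g)\<^sup>2"
    using j r by (simp add: algebra_simps of_nat_diff)
  finally have cj: "1 - (c j)\<^sup>2 \<le> r * (e / g)\<^sup>2" .
  \<comment> \<open>\<open>\<parallel>s \<phi> - n\<parallel>\<^sup>2 = 2 - 2 \<bar>c\<bar> \<le> 2 (1 - c\<^sup>2)\<close> since \<open>\<bar>c\<bar> \<le> 1\<close>\<close>
  define s :: real where "s = (if 0 \<le> c j then 1 else -1)"
  have \<phi>j: "\<phi> j \<in> L2_vec a b p" "ip (\<phi> j) (\<phi> j) = 1"
    using \<phi>_orthonormal[of r] j by (auto simp: L2_orthonormal_def)
  have c1: "\<bar>c j\<bar> \<le> 1"
    using L2_Cauchy_Schwarz[OF \<phi>j(1) nj(1)] \<phi>j(2) nj(3) by (simp add: c_def L2_norm_def)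
  have "ip (\<lambda>i u. s * \<phi> j i u - n j i u) (\<lambda>i u. s * \<phi> j i u - n j i u) = 2 - 2 * \<bar>c j\<bar>"
    using L2_inner_comb2_self[OF \<phi>j(1) nj(1), of s "-1"] \<phi>j(2) nj(2)
    by (simp add: s_def flip: c_def)
  also have "\<dots> \<le> 2 * (1 - (c j)\<^sup>2)"
    using c1 mult_left_mono[OF c1, of "\<bar>c j\<bar>"] by (simp add: power2_eq_square)
  also have "\<dots> \<le> 2 * r * (e / g)\<^sup>2"
    using cj by simp
  finally have "L2_norm a b p (\<lambda>i u. s * \<phi> j i u - n j i u) \<le> sqrt (2 * r * (e / g)\<^sup>2)"
    unfolding L2_norm_def by (rule real_sqrt_le_mono)
  also have "\<dots> = sqrt (2 * r) * (e / g)"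
    using e_nonneg g(1) by (simp add: real_sqrt_mult)
  finally show ?thesis
    by (intro bexI[of _ s]) (auto simp: s_def)
qed

end

subsection \<open>Covariance functions\<close>

lemma square_integrable_const: "finite_measure M \<Longrightarrow> square_integrable M (\<lambda>_. c)"
  by (simp add: square_integrable_def finite_measure.integrable_const)

lemma (in prob_space) integrable_of_square_integrable:
  assumes "square_integrable M X"
  shows "integrable M X"
  using square_integrable_mult[OF assms square_integrable_const[OF finite_measure_axioms, of 1]] by simp

lemma (in prob_space) covariance_eq:
  assumes X: "square_integrable M X" and Y: "square_integrable M Y"
  shows "covariance M X Y = expectation (\<lambda>w. X w * Y w) - expectation X * expectation Y"
proof -
  have "covariance M X Y = expectation (\<lambda>w. X w * Y w - X w * expectation Y - expectation X * Y w + expectation X * expectation Y)"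
    unfolding covariance_def by (intro Bochner_Integration.integral_cong) (auto simp: algebra_simps)
  then show ?thesis
    using integrable_of_square_integrable[OF X] integrable_of_square_integrable[OF Y] square_integrable_mult[OF X Y]
    by (simp add: prob_space)
qed

lemma covariance_commute: "covariance M X Y = covariance M Y X"
  by (simp add: covariance_def mult.commute)

lemma covariance_cong:
  assumes "\<And>w. w \<in> space M \<Longrightarrow> X w = X' w" "\<And>w. w \<in> space M \<Longrightarrow> Y w = Y' w"
  shows "covariance M X Y = covariance M X' Y'"
proof -
  have "(LINT w|M. X w) = (LINT w|M. X' w)" "(LINT w|M. Y w) = (LINT w|M. Y' w)"
    using assms by (auto intro: Bochner_Integration.integral_cong)
  then show ?thesis
    unfolding covariance_def using assms by (intro Bochner_Integration.integral_cong) auto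
qed

lemma (in prob_space) covariance_lincomb_left:
  assumes X: "\<And>k. k \<in> I \<Longrightarrow> square_integrable M (X k)"
    and Z: "square_integrable M Z" and Y: "square_integrable M Y"
  shows "covariance M (\<lambda>w. (\<Sum>k\<in>I. c k * X k w) + Z w) Y =
    (\<Sum>k\<in>I. c k * covariance M (X k) Y) + covariance M Z Y"
proof -
  have S: "square_integrable M (\<lambda>w. (\<Sum>k\<in>I. c k * X k w) + Z w)"
    using X Z by (intro square_integrable_add square_integrable_sum square_integrable_scale)
  have XY: "integrable M (\<lambda>w. c k * (X k w * Y w))" "integrable M (\<lambda>w. c k * X k w)" if "k \<in> I" for k
    using square_integrable_mult[OF X[OF that] Y] integrable_of_square_integrable[OF X[OF that]] by auto
  have "expectation (\<lambda>w. ((\<Sum>k\<in>I. c k * X k w) + Z w) * Y w) =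
      expectation (\<lambda>w. (\<Sum>k\<in>I. c k * (X k w * Y w)) + Z w * Y w)"
    by (simp add: distrib_right sum_distrib_right mult.assoc)
  also have "\<dots> = (\<Sum>k\<in>I. c k * expectation (\<lambda>w. X k w * Y w)) + expectation (\<lambda>w. Z w * Y w)"
    using XY square_integrable_mult[OF Z Y] by (subst Bochner_Integration.integral_add) auto
  finally have 1: "expectation (\<lambda>w. ((\<Sum>k\<in>I. c k * X k w) + Z w) * Y w) =
      (\<Sum>k\<in>I. c k * expectation (\<lambda>w. X k w * Y w)) + expectation (\<lambda>w. Z w * Y w)" .
  have 2: "expectation (\<lambda>w. (\<Sum>k\<in>I. c k * X k w) + Z w) = (\<Sum>k\<in>I. c k * expectation (X k)) + expectation Z"
    using XY integrable_of_square_integrable[OF Z] by (subst Bochner_Integration.integral_add) auto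
  show ?thesis
    unfolding covariance_eq[OF S Y] 1 2 using X
    by (simp add: covariance_eq Y Z algebra_simps sum_subtractf sum_distrib_left sum_distrib_right)
qed

lemma random_functions_square_integrable:
  assumes z: "random_functions M a b p z" and i: "i \<in> {1..p}" and u: "u \<in> {a..b}"
  shows "square_integrable M (z i u)"
proof -
  have "(\<lambda>(w, u). z i u w) \<in> borel_measurable (M \<Otimes>\<^sub>M leb_Icc a b)"
    using z i by (auto simp: random_functions_def)
  from measurable_compose[OF measurable_Pair2' this, of u] u
  have "z i u \<in> borel_measurable M"
    by simp
  then show ?thesis
    using z i u by (auto simp: random_functions_def square_integrable_def)
qed

text \<open>Cauchy-Schwarz in the probability space bounds the squared covariance by the product of
  the second moments \<open>S i u\<close> and \<open>S j v\<close>, each integrable over [a,b] by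
  Fubini. Measurability comes from writing the covariance as an integral over w of a function
  jointly measurable in u, v and w.\<close>

lemma (in prob_space) covariance_square_integrable_kernel:
  assumes z: "random_functions M a b p z" and cov: "is_cov_function M a b p z K"
  shows "square_integrable_kernel a b p K"
  unfolding square_integrable_kernel_def
proof (intro ballI)
  fix i j assume ij: "i \<in> {1..p}" "j \<in> {1..p}"
  interpret P: pair_sigma_finite M "leb_Icc a b" ..
  define m where "m h u = (LINT w|M. z h u w)" for h u
  define S where "S h u = (LINT w|M. (z h u w)\<^sup>2)" for h u
  have zm: "(\<lambda>x. z h (snd x) (fst x)) \<in> borel_measurable (M \<Otimes>\<^sub>M leb_Icc a b)" if "h \<in> {1..p}" for h
    using z that unfolding random_functions_def case_prod_beta by blast
  \<comment> \<open>The pair is swapped so that the variable to be integrated out comes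
    second.\<close>
  have zm': "(\<lambda>x. z h (fst x) (snd x)) \<in> borel_measurable (leb_Icc a b \<Otimes>\<^sub>M M)" if "h \<in> {1..p}" for h
    using measurable_compose[OF measurable_pair_swap' zm[OF that]] by (simp add: case_prod_beta)
  have mm: "m h \<in> borel_measurable (leb_Icc a b)" if "h \<in> {1..p}" for h
    unfolding m_def using zm'[OF that] by (intro borel_measurable_lebesgue_integral) (simp add: case_prod_beta)
  have dm: "(\<lambda>x. z h (fst x) (snd x) - m h (fst x)) \<in> borel_measurable (leb_Icc a b \<Otimes>\<^sub>M M)" if "h \<in> {1..p}" for h
    using zm'[OF that] measurable_compose[OF measurable_fst mm[OF that]] by (rule borel_measurable_diff)
  have "(\<lambda>x. (z i (fst (fst x)) (snd x) - m i (fst (fst x))) * (z j (snd (fst x)) (snd x) - m j (snd (fst x))))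
      \<in> borel_measurable ((leb_Icc a b \<Otimes>\<^sub>M leb_Icc a b) \<Otimes>\<^sub>M M)"
  proof (rule borel_measurable_times)
    \<comment> \<open>The triple ((u, v), w) is projected to (u, w) here and to (v, w) next, which
      pulls both centered factors back to the triple product.\<close>
    have 1: "(\<lambda>x. (fst (fst x), snd x)) \<in> (leb_Icc a b \<Otimes>\<^sub>M leb_Icc a b) \<Otimes>\<^sub>M M \<rightarrow>\<^sub>M leb_Icc a b \<Otimes>\<^sub>M M"
      by (intro measurable_Pair measurable_compose[OF measurable_fst measurable_fst] measurable_snd)
    have 2: "(\<lambda>x. (snd (fst x), snd x)) \<in> (leb_Icc a b \<Otimes>\<^sub>M leb_Icc a b) \<Otimes>\<^sub>M M \<rightarrow>\<^sub>M leb_Icc a b \<Otimes>\<^sub>M M"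
      by (intro measurable_Pair measurable_compose[OF measurable_fst measurable_snd] measurable_snd)
    show "(\<lambda>x. z i (fst (fst x)) (snd x) - m i (fst (fst x))) \<in> borel_measurable ((leb_Icc a b \<Otimes>\<^sub>M leb_Icc a b) \<Otimes>\<^sub>M M)"
      using measurable_compose[OF 1 dm[OF ij(1)]] by simp
    show "(\<lambda>x. z j (snd (fst x)) (snd x) - m j (snd (fst x))) \<in> borel_measurable ((leb_Icc a b \<Otimes>\<^sub>M leb_Icc a b) \<Otimes>\<^sub>M M)"
      using measurable_compose[OF 2 dm[OF ij(2)]] by simp
  qed
  then have "(\<lambda>x. LINT w|M. (z i (fst x) w - m i (fst x)) * (z j (snd x) w - m j (snd x)))
      \<in> borel_measurable (leb_Icc a b \<Otimes>\<^sub>M leb_Icc a b)"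
    by (intro borel_measurable_lebesgue_integral) (simp add: case_prod_beta)
  moreover have K: "K i j u v = (LINT w|M. (z i u w - m i u) * (z j v w - m j v))" if "u \<in> {a..b}" "v \<in> {a..b}" for u v
    using cov ij that by (simp add: is_cov_function_def covariance_def m_def)
  ultimately have meas: "(\<lambda>x. K i j (fst x) (snd x)) \<in> borel_measurable (leb_Icc a b \<Otimes>\<^sub>M leb_Icc a b)"
    by (subst measurable_cong[OF K]) (auto simp: space_pair_measure)
  have S: "integrable (leb_Icc a b) (S h)" if "h \<in> {1..p}" for h
    unfolding S_def using z that P.integrable_snd[of "\<lambda>w u. (z h u w)\<^sup>2"] by (auto simp: random_functions_def)
  have bound: "(K i j u v)\<^sup>2 \<le> S i u * S j v" if uv: "u \<in> {a..b}" "v \<in> {a..b}" for u v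
  proof -
    \<comment> \<open>Centering can only decrease the second moment.\<close>
    have V: "square_integrable M (\<lambda>w. z h x w - m h x)" "(LINT w|M. (z h x w - m h x)\<^sup>2) \<le> S h x"
      if "h \<in> {1..p}" "x \<in> {a..b}" for h x
    proof -
      have sq: "square_integrable M (z h x)"
        by (rule random_functions_square_integrable[OF z that])
      show "square_integrable M (\<lambda>w. z h x w - m h x)"
        using square_integrable_add[OF sq square_integrable_const[OF finite_measure_axioms, of "- m h x"]] by simp
      show "(LINT w|M. (z h x w - m h x)\<^sup>2) \<le> S h x"
        using variance_eq[OF integrable_of_square_integrable[OF sq] square_integrableD(2)[OF sq]]
        by (simp add: m_def S_def)
    qed
    have "(K i j u v)\<^sup>2 \<le> (LINT w|M. (z i u w - m i u)\<^sup>2) * (LINT w|M. (z j v w - m j v)\<^sup>2)"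
      unfolding K[OF uv] using ij uv by (intro Cauchy_Schwarz_LINT V)
    also have "\<dots> \<le> S i u * S j v"
      using V ij uv by (intro mult_mono) (auto simp: S_def)
    finally show ?thesis .
  qed
  have "integrable (leb_Icc a b \<Otimes>\<^sub>M leb_Icc a b) (\<lambda>x. (K i j (fst x) (snd x))\<^sup>2)"
  proof (rule Bochner_Integration.integrable_bound[OF leb_Icc_pair.integrable_tensor[OF S[OF ij(1)] S[OF ij(2)]]])
    show "(\<lambda>x. (K i j (fst x) (snd x))\<^sup>2) \<in> borel_measurable (leb_Icc a b \<Otimes>\<^sub>M leb_Icc a b)"
      by (rule borel_measurable_power[OF meas])
    show "AE x in leb_Icc a b \<Otimes>\<^sub>M leb_Icc a b.
        norm ((K i j (fst x) (snd x))\<^sup>2) \<le> norm (S i (fst x) * S j (snd x))"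
    proof (rule AE_I2)
      fix x assume "x \<in> space (leb_Icc a b \<Otimes>\<^sub>M leb_Icc a b)"
      then have "(K i j (fst x) (snd x))\<^sup>2 \<le> S i (fst x) * S j (snd x)"
        by (intro bound) (auto simp: space_pair_measure)
      then show "norm ((K i j (fst x) (snd x))\<^sup>2) \<le> norm (S i (fst x) * S j (snd x))"
        unfolding real_norm_def abs_power2 by linarith
    qed
  qed
  with meas show "square_integrable (leb_Icc a b \<Otimes>\<^sub>M leb_Icc a b) (\<lambda>x. K i j (fst x) (snd x))"
    by (simp add: square_integrable_def)
qed

text \<open>Bilinear expansion of the covariance: the cross terms between factors and noise vanish
  on both sides, and the identity covariance of the factors collapses the double sum to its
  diagonal.\<close>

lemma (in prob_space) factor_model_covariance:
  fixes r :: nat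
  assumes \<gamma>: "\<And>k. k \<in> {1..r} \<Longrightarrow> square_integrable M (\<gamma> k)"
    and \<epsilon>: "random_functions M a b p \<epsilon>"
    and y: "\<And>i u w. i \<in> {1..p} \<Longrightarrow> u \<in> {a..b} \<Longrightarrow> w \<in> space M \<Longrightarrow>
      y i u w = (\<Sum>k\<in>{1..r}. Q i k u * \<gamma> k w) + \<epsilon> i u w"
    and uncorr: "\<And>k i u. k \<in> {1..r} \<Longrightarrow> i \<in> {1..p} \<Longrightarrow> u \<in> {a..b} \<Longrightarrow> covariance M (\<gamma> k) (\<epsilon> i u) = 0"
    and unit: "\<And>k l. k \<in> {1..r} \<Longrightarrow> l \<in> {1..r} \<Longrightarrow> covariance M (\<gamma> k) (\<gamma> l) = (if k = l then 1 else 0)"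
    and E: "is_cov_function M a b p \<epsilon> E" and K: "is_cov_function M a b p y K"
    and ij: "i \<in> {1..p}" "j \<in> {1..p}" and uv: "u \<in> {a..b}" "v \<in> {a..b}"
  shows "K i j u v = (\<Sum>k\<in>{1..r}. Q i k u * Q j k v) + E i j u v"
proof -
  let ?y = "\<lambda>i u w. (\<Sum>k\<in>{1..r}. Q i k u * \<gamma> k w) + \<epsilon> i u w"
  have \<epsilon>2: "square_integrable M (\<epsilon> i u)" "square_integrable M (\<epsilon> j v)"
    using random_functions_square_integrable[OF \<epsilon>] ij uv by auto
  have y2: "square_integrable M (?y j v)"
    using \<gamma> \<epsilon>2 by (intro square_integrable_add square_integrable_sum square_integrable_scale)
  have right: "covariance M X (?y j v) = (\<Sum>k\<in>{1..r}. Q j k v * covariance M X (\<gamma> k)) + covariance M X (\<epsilon> j v)"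
    if "square_integrable M X" for X
    using covariance_lincomb_left[of "{1..r}" \<gamma> "\<epsilon> j v" X "\<lambda>k. Q j k v", OF \<gamma> \<epsilon>2(2) that] by (simp add: covariance_commute)
  have "K i j u v = covariance M (y i u) (y j v)"
    using K ij uv by (simp add: is_cov_function_def)
  also have "\<dots> = covariance M (?y i u) (?y j v)"
    using ij uv by (intro covariance_cong y)
  also have "\<dots> = (\<Sum>k\<in>{1..r}. Q i k u * covariance M (\<gamma> k) (?y j v)) + covariance M (\<epsilon> i u) (?y j v)"
    by (rule covariance_lincomb_left[OF \<gamma> \<epsilon>2(1) y2])
  also have "(\<Sum>k\<in>{1..r}. Q i k u * covariance M (\<gamma> k) (?y j v)) = (\<Sum>k\<in>{1..r}. Q i k u * Q j k v)"
  proof (rule sum.cong[OF refl])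
    fix k assume k: "k \<in> {1..r}"
    have "covariance M (\<gamma> k) (?y j v) = (\<Sum>l\<in>{1..r}. if l = k then Q j l v else 0)"
      unfolding right[OF \<gamma>[OF k]] uncorr[OF k ij(2) uv(2)] add_0_right
      by (intro sum.cong refl) (auto simp: unit[OF k])
    then show "Q i k u * covariance M (\<gamma> k) (?y j v) = Q i k u * Q j k v"
      using k by simp
  qed
  also have "covariance M (\<epsilon> i u) (?y j v) = E i j u v"
  proof -
    have "covariance M (\<epsilon> i u) (\<gamma> k) = 0" if "k \<in> {1..r}" for k
      using uncorr[OF that ij(1) uv(1)] by (simp add: covariance_commute)
    then show ?thesis
      unfolding right[OF \<epsilon>2(1)] using E ij uv by (simp add: is_cov_function_def)
  qed
  finally show ?thesis .
qed

text \<open>Passes from neighbours to arbitrary pairs: with d = 0 it gives monotonicity of \<theta>,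
  with d = \<delta> a uniform separation. One step already achieves the drop d, and the remaining
  steps do not undo it because \<open>0 \<le> d\<close>.\<close>

lemma decrease_on_Icc:
  fixes f :: "nat \<Rightarrow> real"
  assumes step: "\<And>k. k \<in> {1..<r} \<Longrightarrow> f (Suc k) \<le> f k - d" and "0 \<le> d" and "1 \<le> j"
  shows "j < k \<Longrightarrow> k \<le> r \<Longrightarrow> f k \<le> f j - d"
proof (induction k)
  case (Suc k)
  show ?case
  proof (cases "k = j")
    case True
    then show ?thesis using step[of j] Suc.prems \<open>1 \<le> j\<close> by simp
  next
    case False
    then have "f k \<le> f j - d"
      using Suc by simp
    then show ?thesis
      using step[of k] Suc.prems \<open>0 \<le> d\<close> \<open>1 \<le> j\<close> by simp
  qed
qed simp

theorem proposition2:
  fixes a b :: real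
    and r :: nat
    and M :: "nat \<Rightarrow> 'w measure"
    and Q :: "nat \<Rightarrow> nat \<Rightarrow> nat \<Rightarrow> real \<Rightarrow> real"
    and \<gamma> :: "nat \<Rightarrow> 't \<Rightarrow> nat \<Rightarrow> 'w \<Rightarrow> real"
    and \<epsilon> y :: "nat \<Rightarrow> 't \<Rightarrow> nat \<Rightarrow> real \<Rightarrow> 'w \<Rightarrow> real"
    and \<Sigma>\<gamma> :: "nat \<Rightarrow> nat \<Rightarrow> nat \<Rightarrow> real"
    and \<Sigma>\<epsilon> \<Sigma>y :: "nat \<Rightarrow> nat \<Rightarrow> nat \<Rightarrow> real \<Rightarrow> real \<Rightarrow> real"
    and \<tau> :: "nat \<Rightarrow> nat \<Rightarrow> real"
    and \<phi> :: "nat \<Rightarrow> nat \<Rightarrow> nat \<Rightarrow> real \<Rightarrow> real"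
    and \<theta> :: "nat \<Rightarrow> nat \<Rightarrow> real"
    and \<theta>_lo \<theta>_up :: real
  assumes "a < b" and "r \<ge> 1"
    \<comment> \<open>the factor model\<close>
    and "\<And>p. p \<ge> 1 \<Longrightarrow> prob_space (M p)"
    and "\<And>p j. p \<ge> 1 \<Longrightarrow> j \<in> {1..r} \<Longrightarrow> mat_col (Q p) j \<in> L2_vec a b p"
    and "\<And>p t k. p \<ge> 1 \<Longrightarrow> k \<in> {1..r} \<Longrightarrow>
          \<gamma> p t k \<in> borel_measurable (M p) \<and> integrable (M p) (\<lambda>w. (\<gamma> p t k w)\<^sup>2)"
    and "\<And>p t. p \<ge> 1 \<Longrightarrow> random_functions (M p) a b p (\<epsilon> p t)"
    and "\<And>p t i u w. p \<ge> 1 \<Longrightarrow> i \<in> {1..p} \<Longrightarrow> u \<in> {a..b} \<Longrightarrow> w \<in> space (M p) \<Longrightarrow>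
          y p t i u w = (\<Sum>k\<in>{1..r}. Q p i k u * \<gamma> p t k w) + \<epsilon> p t i u w"
    and "\<And>p t k i u. p \<ge> 1 \<Longrightarrow> k \<in> {1..r} \<Longrightarrow> i \<in> {1..p} \<Longrightarrow> u \<in> {a..b} \<Longrightarrow>
          covariance (M p) (\<gamma> p t k) (\<epsilon> p t i u) = 0"
    \<comment> \<open>covariance matrices, covariance matrix functions, and the eigensystem of the latter\<close>
    and "\<And>p t k l. p \<ge> 1 \<Longrightarrow> k \<in> {1..r} \<Longrightarrow> l \<in> {1..r} \<Longrightarrow>
          \<Sigma>\<gamma> p k l = covariance (M p) (\<gamma> p t k) (\<gamma> p t l)"
    and "\<And>p t. p \<ge> 1 \<Longrightarrow> is_cov_function (M p) a b p (\<epsilon> p t) (\<Sigma>\<epsilon> p)"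
    and "\<And>p t. p \<ge> 1 \<Longrightarrow> is_cov_function (M p) a b p (y p t) (\<Sigma>y p)"
    and "\<And>p. p \<ge> 1 \<Longrightarrow> mercer_system a b p (\<Sigma>y p) (\<tau> p) (\<phi> p)"
    \<comment> \<open>identification and strength of the factors\<close>
    and "\<And>p k l. p \<ge> 1 \<Longrightarrow> k \<in> {1..r} \<Longrightarrow> l \<in> {1..r} \<Longrightarrow>
          \<Sigma>\<gamma> p k l = (if k = l then 1 else 0)"
    and "\<And>p j k. p \<ge> 1 \<Longrightarrow> j \<in> {1..r} \<Longrightarrow> k \<in> {1..r} \<Longrightarrow>
          L2_inner a b p (mat_col (Q p) j) (mat_col (Q p) k) / real p = (if j = k then \<theta> p j else 0)"
    and "0 < \<theta>_lo" and "\<theta>_lo < \<theta>_up"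
    and "\<And>p. p \<ge> 1 \<Longrightarrow> \<theta> p 1 < \<theta>_up"
    and "\<And>p j. p \<ge> 1 \<Longrightarrow> j \<in> {1..<r} \<Longrightarrow> \<theta> p (Suc j) < \<theta> p j"
    and "\<And>p. p \<ge> 1 \<Longrightarrow> \<theta>_lo < \<theta> p r"
    and "(\<lambda>p. kernel_opnorm a b p (\<Sigma>\<epsilon> p)) \<in> o(\<lambda>p. real p)"
  shows
    \<comment> \<open>For the eigenfunctions, the gaps must not close as \<open>p\<close> grows, which is automatic if
      \<open>\<theta>\<close> does not depend on \<open>p\<close>; eigenfunctions are determined only up to sign.\<close>
    "(\<forall>p\<ge>1. (\<forall>j\<in>{1..r}. \<bar>\<tau> p j - real p * \<theta> p j\<bar> \<le> kernel_opnorm a b p (\<Sigma>\<epsilon> p)) \<and>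
             (\<forall>j\<in>{1..p} - {1..r}. \<bar>\<tau> p j\<bar> \<le> kernel_opnorm a b p (\<Sigma>\<epsilon> p))) \<and>
     ((\<exists>\<delta>>0. \<forall>p\<ge>1. \<forall>j\<in>{1..<r}. \<theta> p j - \<theta> p (Suc j) \<ge> \<delta>) \<longrightarrow>
      (\<forall>j\<in>{1..r}. \<exists>s :: nat \<Rightarrow> real. (\<forall>p. s p \<in> {-1, 1}) \<and>
        (\<lambda>p. L2_norm a b p (\<lambda>i u. s p * \<phi> p j i u - normalized_col a b p (Q p) j i u))
          \<in> O(\<lambda>p. kernel_opnorm a b p (\<Sigma>\<epsilon> p) / real p)))"
proof -
  \<comment> \<open>The covariance functions are common to all time points, so they can be computed
    at an arbitrary one.\<close>
  define t :: 't where "t = undefined"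
  have \<theta>_antimono: "\<theta> p k \<le> \<theta> p j" if "1 \<le> p" "j \<in> {1..r}" "k \<in> {1..r}" "j \<le> k" for p j k
    using decrease_on_Icc[of r "\<theta> p" 0 j k] assms(18)[OF that(1)] that by (cases "j = k") (auto intro: less_imp_le)
  have \<theta>_lower: "\<theta>_lo < \<theta> p k" if "1 \<le> p" "k \<in> {1..r}" for p k
    using \<theta>_antimono[OF that(1,2), of r] assms(19)[OF that(1)] that(2) by simp
  have model: "perturbed_factor_kernel a b p r (\<Sigma>y p) (\<Sigma>\<epsilon> p) (mat_col (Q p)) (\<phi> p) (\<lambda>k. real p * \<theta> p k) (\<tau> p)"
    if p: "1 \<le> p" for p
  proof -
    interpret prob_space "M p"
      by (rule assms(3)[OF p])
    have \<gamma>: "square_integrable (M p) (\<gamma> p t k)" if "k \<in> {1..r}" for k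
      using assms(5)[OF p that, of t] by (simp add: square_integrable_def)
    have unit: "covariance (M p) (\<gamma> p t k) (\<gamma> p t l) = (if k = l then 1 else 0)"
      if "k \<in> {1..r}" "l \<in> {1..r}" for k l
      using assms(9)[OF p that, of t] assms(13)[OF p that] by simp
    note \<epsilon> = assms(6)[OF p, of t] and E = assms(10)[OF p, of t]
    show ?thesis
    proof
      show "1 \<le> r"
        by (rule assms(2))
      show "square_integrable_kernel a b p (\<Sigma>\<epsilon> p)"
        by (rule covariance_square_integrable_kernel[OF \<epsilon> E])
      show "\<Sigma>\<epsilon> p i j u v = \<Sigma>\<epsilon> p j i v u"
        if "i \<in> {1..p}" "j \<in> {1..p}" "u \<in> {a..b}" "v \<in> {a..b}" for i j u v
        using E that by (simp add: is_cov_function_def covariance_commute[of "M p" "\<epsilon> p t i u"])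
      show "mat_col (Q p) k \<in> L2_vec a b p" if "k \<in> {1..r}" for k
        by (rule assms(4)[OF p that])
      show "\<Sigma>y p i j u v = (\<Sum>k\<in>{1..r}. mat_col (Q p) k i u * mat_col (Q p) k j v) + \<Sigma>\<epsilon> p i j u v"
        if "i \<in> {1..p}" "j \<in> {1..p}" "u \<in> {a..b}" "v \<in> {a..b}" for i j u v
        unfolding mat_col_def
        by (rule factor_model_covariance[OF \<gamma> \<epsilon> assms(7)[OF p] assms(8)[OF p] unit E assms(11)[OF p, of t] that])
      show "mercer_system a b p (\<Sigma>y p) (\<tau> p) (\<phi> p)"
        by (rule assms(12)[OF p])
      show "L2_inner a b p (mat_col (Q p) j) (mat_col (Q p) k) = (if j = k then real p * \<theta> p j else 0)"
        if "j \<in> {1..r}" "k \<in> {1..r}" for j k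
        using assms(14)[OF p that] p by (auto simp: field_simps split: if_splits)
      show "0 < real p * \<theta> p k" if "k \<in> {1..r}" for k
        using \<theta>_lower[OF p that] assms(15) p by simp
      show "real p * \<theta> p k \<le> real p * \<theta> p j" if "j \<in> {1..r}" "k \<in> {1..r}" "j \<le> k" for j k
        using \<theta>_antimono[OF p that] by (simp add: mult_left_mono)
    qed
  qed
  have eigenvalues: "\<bar>\<tau> p j - real p * \<theta> p j\<bar> \<le> kernel_opnorm a b p (\<Sigma>\<epsilon> p)" if "1 \<le> p" "j \<in> {1..r}" for p j
  proof -
    interpret perturbed_factor_kernel a b p r "\<Sigma>y p" "\<Sigma>\<epsilon> p" "mat_col (Q p)" "\<phi> p" "\<lambda>k. real p * \<theta> p k" "\<tau> p"
      by (rule model[OF that(1)])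
    show ?thesis
      using eigenvalue_upper[of j] eigenvalue_lower[OF that(2)] that(2) by (simp add: e_def)
  qed
  have rest: "\<bar>\<tau> p j\<bar> \<le> kernel_opnorm a b p (\<Sigma>\<epsilon> p)" if "1 \<le> p" "j \<in> {1..p} - {1..r}" for p j
  proof -
    interpret perturbed_factor_kernel a b p r "\<Sigma>y p" "\<Sigma>\<epsilon> p" "mat_col (Q p)" "\<phi> p" "\<lambda>k. real p * \<theta> p k" "\<tau> p"
      by (rule model[OF that(1)])
    show ?thesis
      using eigenvalue_upper[of j] mercer_systemD(1)[OF mercer, of j] that(2) by (simp add: e_def)
  qed
  have eigenfunctions: "\<exists>s :: nat \<Rightarrow> real. (\<forall>p. s p \<in> {-1, 1}) \<and>
        (\<lambda>p. L2_norm a b p (\<lambda>i u. s p * \<phi> p j i u - normalized_col a b p (Q p) j i u))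
          \<in> O(\<lambda>p. kernel_opnorm a b p (\<Sigma>\<epsilon> p) / real p)"
    if \<delta>: "0 < \<delta>" "\<And>p j. 1 \<le> p \<Longrightarrow> j \<in> {1..<r} \<Longrightarrow> \<theta> p j - \<theta> p (Suc j) \<ge> \<delta>" and j: "j \<in> {1..r}" for \<delta> j
  proof -
    \<comment> \<open>Chosen so that \<open>g = d * real p\<close> meets the hypotheses of
      \<open>eigenfunction_close\<close>: 2 g is at most p \<delta>, hence at most every gap, and at
      most p \<theta>_lo, hence at most every p \<theta> j. The ratio \<open>e / g\<close> then has
      order \<open>e / real p\<close>.\<close>
    define d where "d = min \<delta> \<theta>_lo / 2"
    have d: "0 < d" "2 * d \<le> \<delta>" "2 * d \<le> \<theta>_lo"
      using \<delta>(1) assms(15) by (auto simp: d_def)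
    let ?close = "\<lambda>p s. L2_norm a b p (\<lambda>i u. s * \<phi> p j i u - normalized_col a b p (Q p) j i u)
        \<le> sqrt (2 * r) / d * (kernel_opnorm a b p (\<Sigma>\<epsilon> p) / real p)"
    have close: "\<exists>s\<in>{-1, 1}. ?close p s"
      if p: "1 \<le> p" and small: "kernel_opnorm a b p (\<Sigma>\<epsilon> p) \<le> d * real p" for p
    proof -
      interpret perturbed_factor_kernel a b p r "\<Sigma>y p" "\<Sigma>\<epsilon> p" "mat_col (Q p)" "\<phi> p" "\<lambda>k. real p * \<theta> p k" "\<tau> p"
        by (rule model[OF p])
      have gap: "2 * d \<le> \<bar>\<theta> p k - \<theta> p l\<bar>" if "k \<in> {1..r}" "l \<in> {1..r}" "k < l" for k l
        using decrease_on_Icc[of r "\<theta> p" \<delta> k l] \<delta>(1) \<delta>(2)[OF p] d(2) that by fastforce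
      have "\<exists>s\<in>{-1, 1}. L2_norm a b p (\<lambda>i u. s * \<phi> p j i u - n j i u) \<le> sqrt (2 * r) * (e / (d * real p))"
      proof (rule eigenfunction_close[OF j])
        show "0 < d * real p"
          using d p by simp
        show "e \<le> d * real p"
          using small by (simp add: e_def)
        show "2 * (d * real p) \<le> real p * \<theta> p j"
          using \<theta>_lower[OF p j] d(3) p mult_left_mono[of "2 * d" "\<theta> p j" "real p"] by (simp add: mult_ac)
        show "2 * (d * real p) \<le> \<bar>real p * \<theta> p k - real p * \<theta> p j\<bar>" if "k \<in> {1..r}" "k \<noteq> j" for k
        proof -
          have "2 * d \<le> \<bar>\<theta> p k - \<theta> p j\<bar>"
            using gap[of k j] gap[of j k] that j by (cases "k < j") (auto simp: abs_minus_commute)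
          then have "real p * (2 * d) \<le> real p * \<bar>\<theta> p k - \<theta> p j\<bar>"
            by (rule mult_left_mono) simp
          then show ?thesis
            by (simp add: mult_ac abs_mult flip: right_diff_distrib)
        qed
      qed
      \<comment> \<open>By \<open>q_inner\<close>, the norm of column j is the square root of p
        \<theta> j.\<close>
      moreover have "n j = normalized_col a b p (Q p) j"
        using q_inner[OF j j] by (simp add: n_def normalized_col_def L2_norm_def fun_eq_iff) (simp add: mat_col_def)
      ultimately show ?thesis
        by (simp add: e_def mult_ac)
    qed
    \<comment> \<open>The sign depends on p. If -1 fails, \<open>close\<close> guarantees 1 whenever
      the noise is small; the default 1 keeps s p in {-1, 1} for all other p.\<close>
    define s where "s p = (if ?close p (- 1) then - 1 else 1 :: real)" for p
    have s: "?close p (s p)" if "1 \<le> p" "kernel_opnorm a b p (\<Sigma>\<epsilon> p) \<le> d * real p" for p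
    proof (cases "?close p (- 1)")
      case False
      then show ?thesis
        using close[OF that] unfolding s_def by (simp only: bex_simps if_False) blast
    qed (simp only: s_def if_True)
    \<comment> \<open>The o(p) assumption at the constant \<open>d\<close>: the smallness required
      by \<open>close\<close> holds for all large p.\<close>
    have "eventually (\<lambda>p. norm (kernel_opnorm a b p (\<Sigma>\<epsilon> p)) \<le> d * norm (real p)) at_top"
      using landau_o.smallD[OF assms(20) d(1)] .
    then have "eventually (\<lambda>p. norm (L2_norm a b p (\<lambda>i u. s p * \<phi> p j i u - normalized_col a b p (Q p) j i u))
        \<le> sqrt (2 * r) / d * norm (kernel_opnorm a b p (\<Sigma>\<epsilon> p) / real p)) at_top"
      using eventually_ge_at_top[of 1]
    proof eventually_elim
      case (elim p)
      then have "?close p (s p)"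
        by (intro s) auto
      also have "sqrt (2 * r) / d * (kernel_opnorm a b p (\<Sigma>\<epsilon> p) / real p) \<le>
          sqrt (2 * r) / d * norm (kernel_opnorm a b p (\<Sigma>\<epsilon> p) / real p)"
        using d(1) by (intro mult_left_mono) (auto simp: divide_right_mono)
      finally show ?case
        by (simp add: L2_norm_nonneg)
    qed
    then show ?thesis
      by (intro exI[of _ s] conjI allI bigoI) (simp add: s_def)
  qed
  show ?thesis
  proof (intro conjI allI impI ballI)
    fix j assume "\<exists>\<delta>>0. \<forall>p\<ge>1. \<forall>j\<in>{1..<r}. \<theta> p j - \<theta> p (Suc j) \<ge> \<delta>" and "j \<in> {1..r}"
    then show "\<exists>s :: nat \<Rightarrow> real. (\<forall>p. s p \<in> {-1, 1}) \<and>
        (\<lambda>p. L2_norm a b p (\<lambda>i u. s p * \<phi> p j i u - normalized_col a b p (Q p) j i u))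
          \<in> O(\<lambda>p. kernel_opnorm a b p (\<Sigma>\<epsilon> p) / real p)"
      using eigenfunctions by blast
  qed (use eigenvalues rest in auto)
qed

end
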